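(* Let $N$, $A$, $B$ be finite-dimensional $\mathbb{C}$-algebras of the same dimension, and suppose that $A$ and $B$ are semisimple. Let $\mathcal{N}$ be a formal deformation of $N$. Suppose that $\mathcal{N}$ is a flat deformation from $N$ to $A$, and that $\mathcal{N}$ is also a flat deformation from $N$ to $B$. Then $A$ and $B$ are isomorphic $\mathbb{C}$-algebras. Moreover, $\mathcal{N}$ is a strongly flat deformation from $N$ to $A$.
   Context: All algebras are associative with identity, usually noncommutative. $\mathbb{C}\{t\}$ denotes the ring of power series in $t$ with coefficients in $\mathbb{C}$, and for a finite-dimensional $\mathbb{C}$-algebra $N$, $N\{t\}$ denotes the set of power series in $t$ with coefficients in $N$, with its natural $\mathbb{C}\{t\}$-module structure. Formal deformation: a formal deformation $\mathcal{N}=N\{t\}$ of $N$ is an associative $\mathbb{C}\{t\}$-bilinear multiplication $\circ_t$ on $N\{t\}$ such that for $a,b\in N$ the constant term (coefficient of $t^0$) of $a\circ_t b$ is the product $ab$ in $N$, and such that the identity element of $N$ acts as the identity of $N\{t\}$. Specialisation: let $d_1,\dots,d_n$ be a basis of $N$ over $\mathbb{C}$ and write $d_i\circ_t d_j=\sum_{l=1}^n g_{i,j,l}(t)\,d_l$ with $g_{i,j,l}(t)\in\mathbb{C}\{t\}$. If all $g_{i,j,l}$ converge at $t=s$, the specialisation $N_s$ of $\mathcal{N}$ at $t=s$ is the $\mathbb{C}$-algebra with basis $d_1,\dots,d_n$ and multiplication $d_i\circ_s d_j=\sum_l g_{i,j,l}(s)\,d_l$. Thus $N_0=N$. Flat deformation: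 a formal deformation $\mathcal{N}$ of $N$ is a flat deformation from $N$ to $B$ if (1) there is a real $c>0$ such that all $g_{i,j,l}(t)$ converge for $t\in(0,c)$ (so $N_s$ is defined for all $s\in(0,c)$), and $N_{t_0}\cong B$ for some $t_0\in(0,c)$; and (2) $\dim_{\mathbb{C}}N_s=\dim_{\mathbb{C}}N$ for $0\le s\le t_0$. Strongly flat deformation: let $N$ and $B$ be finite-dimensional $\mathbb{C}$-algebras of the same dimension. A formal deformation $\mathcal{N}$ of $N$ is a strongly flat deformation from $N$ to $B$ if (1) there is a real $c>0$ such that all $g_{i,j,l}(t)$ converge for $t\in[0,c)$, and $N_{t_0}\cong B$ for some $t_0\in(0,c)$; and (2) for every real $\epsilon>0$ there is $s$ with $0<s<\epsilon$ such that $N_s\cong B$. *)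

theory Defs
  imports "HOL-Analysis.Analysis"
begin

text \<open>The algebra operations are record components, not type class operations, because one
  vector space carries a whole family of multiplications below. The additive group comes from
  the type.\<close>

record 'a alg =
  alg_scale :: "complex \<Rightarrow> 'a \<Rightarrow> 'a"
  alg_mult :: "'a \<Rightarrow> 'a \<Rightarrow> 'a"
  alg_one :: "'a"

locale complex_algebra = vector_space "alg_scale A" for A :: "'a::ab_group_add alg" +
  assumes mult_linear_right: "Vector_Spaces.linear (alg_scale A) (alg_scale A) (\<lambda>y. alg_mult A x y)"
    and mult_linear_left: "Vector_Spaces.linear (alg_scale A) (alg_scale A) (\<lambda>x. alg_mult A x y)"
    and mult_assoc: "alg_mult A (alg_mult A x y) z = alg_mult A x (alg_mult A y z)"
    and mult_one_left: "alg_mult A (alg_one A) x = x"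
    and mult_one_right: "alg_mult A x (alg_one A) = x"

definition alg_basis :: "'a::ab_group_add alg \<Rightarrow> 'a set \<Rightarrow> bool" where
  "alg_basis A D \<longleftrightarrow> finite_dimensional_vector_space (alg_scale A) D"

definition alg_dim :: "'a::ab_group_add alg \<Rightarrow> nat" where
  "alg_dim A = vector_space.dim (alg_scale A) UNIV"

definition fin_dim_algebra :: "'a::ab_group_add alg \<Rightarrow> bool" where
  "fin_dim_algebra A \<longleftrightarrow> complex_algebra A \<and> (\<exists>D. alg_basis A D)"

definition alg_iso :: "'a::ab_group_add alg \<Rightarrow> 'b::ab_group_add alg \<Rightarrow> bool" (infix "\<cong>\<^sub>a" 50) where
  "A \<cong>\<^sub>a B \<longleftrightarrow> (\<exists>f. bij f \<and> Vector_Spaces.linear (alg_scale A) (alg_scale B) f \<and>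
     (\<forall>x y. f (alg_mult A x y) = alg_mult B (f x) (f y)) \<and> f (alg_one A) = alg_one B)"

definition left_ideal :: "'a::ab_group_add alg \<Rightarrow> 'a set \<Rightarrow> bool" where
  "left_ideal A I \<longleftrightarrow> module.subspace (alg_scale A) I \<and> (\<forall>a. \<forall>x\<in>I. alg_mult A a x \<in> I)"

text \<open>Semisimple means that the left regular module is semisimple: every submodule, that is,
  every left ideal, is a direct summand. The zero algebra counts as semisimple.\<close>

definition semisimple_algebra :: "'a::ab_group_add alg \<Rightarrow> bool" where
  "semisimple_algebra A \<longleftrightarrow> (\<forall>I. left_ideal A I \<longrightarrow>
     (\<exists>J. left_ideal A J \<and> I \<inter> J = {0} \<and> (\<forall>x. \<exists>i\<in>I. \<exists>j\<in>J. x = i + j)))"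

text \<open>Power series with coefficients in an algebra \<open>N\<close> on the type \<open>'a\<close> are elements of
  \<open>'a fps\<close>, whose addition is coefficientwise. The following is the action of the complex
  power series on them.\<close>

definition fps_act :: "'a::ab_group_add alg \<Rightarrow> complex fps \<Rightarrow> 'a fps \<Rightarrow> 'a fps" where
  "fps_act N p f = Abs_fps (\<lambda>n. \<Sum>i\<le>n. alg_scale N (fps_nth p i) (fps_nth f (n - i)))"

locale formal_deformation = complex_algebra N for N :: "'a::ab_group_add alg" +
  fixes star :: "'a fps \<Rightarrow> 'a fps \<Rightarrow> 'a fps" (infixl "\<star>" 70)
  assumes star_add_left: "(f + g) \<star> h = f \<star> h + g \<star> h"
    and star_add_right: "f \<star> (g + h) = f \<star> g + f \<star> h"
    and star_act_left: "fps_act N p f \<star> g = fps_act N p (f \<star> g)"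
    and star_act_right: "f \<star> fps_act N p g = fps_act N p (f \<star> g)"
    and star_assoc: "(f \<star> g) \<star> h = f \<star> (g \<star> h)"
    and star_const_term: "fps_nth (fps_const a \<star> fps_const b) 0 = alg_mult N a b"
    and star_one_left: "fps_const (alg_one N) \<star> f = f"
    and star_one_right: "f \<star> fps_const (alg_one N) = f"

text \<open>The structure constants of a deformation in a basis \<open>D\<close>, indexed by basis elements:
  the coefficient of \<open>t ^ k\<close> in the series at \<open>(a, b, c)\<close> is the \<open>c\<close>-coordinate of the
  coefficient of \<open>t ^ k\<close> in \<open>a \<star> b\<close>. Lemma \<open>star_basis\<close> below is the defining identity.\<close>

definition structure_series ::
    "'a::ab_group_add alg \<Rightarrow> 'a set \<Rightarrow> ('a fps \<Rightarrow> 'a fps \<Rightarrow> 'a fps) \<Rightarrow> 'a \<Rightarrow> 'a \<Rightarrow> 'a \<Rightarrow> complex fps"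
  where "structure_series N D star a b c = Abs_fps (\<lambda>k.
    module.representation (alg_scale N) D (fps_nth (star (fps_const a) (fps_const b)) k) c)"

definition converges_at ::
    "'a::ab_group_add alg \<Rightarrow> 'a set \<Rightarrow> ('a fps \<Rightarrow> 'a fps \<Rightarrow> 'a fps) \<Rightarrow> complex \<Rightarrow> bool" where
  "converges_at N D star s \<longleftrightarrow> (\<forall>a\<in>D. \<forall>b\<in>D. \<forall>c\<in>D.
     summable (\<lambda>k. fps_nth (structure_series N D star a b c) k * s ^ k))"

text \<open>The specialisation keeps the vector space and the identity of \<open>N\<close> and extends the
  specialised products of basis elements bilinearly. It is meaningful only where the structure
  series converge.\<close>

definition specialisation ::
    "'a::ab_group_add alg \<Rightarrow> 'a set \<Rightarrow> ('a fps \<Rightarrow> 'a fps \<Rightarrow> 'a fps) \<Rightarrow> complex \<Rightarrow> 'a alg" where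
  "specialisation N D star s = N\<lparr>alg_mult := \<lambda>x y.
     \<Sum>a\<in>D. \<Sum>b\<in>D. alg_scale N
       (module.representation (alg_scale N) D x a * module.representation (alg_scale N) D y b)
       (\<Sum>c\<in>D. alg_scale N (eval_fps (structure_series N D star a b c) s) c)\<rparr>"

definition flat_deformation ::
    "'a::ab_group_add alg \<Rightarrow> 'a set \<Rightarrow> ('a fps \<Rightarrow> 'a fps \<Rightarrow> 'a fps) \<Rightarrow> 'b::ab_group_add alg \<Rightarrow> bool" where
  "flat_deformation N D star B \<longleftrightarrow> formal_deformation N star \<and>
     (\<exists>c>0. (\<forall>s\<in>{0<..<c}. converges_at N D star (complex_of_real s)) \<and>
       (\<exists>t0\<in>{0<..<c}. specialisation N D star (complex_of_real t0) \<cong>\<^sub>a B \<and>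
         (\<forall>s\<in>{0..t0}. alg_dim (specialisation N D star (complex_of_real s)) = alg_dim N)))"

definition strongly_flat_deformation ::
    "'a::ab_group_add alg \<Rightarrow> 'a set \<Rightarrow> ('a fps \<Rightarrow> 'a fps \<Rightarrow> 'a fps) \<Rightarrow> 'b::ab_group_add alg \<Rightarrow> bool" where
  "strongly_flat_deformation N D star B \<longleftrightarrow> formal_deformation N star \<and>
     (\<exists>c>0. (\<forall>s\<in>{0..<c}. converges_at N D star (complex_of_real s)) \<and>
       (\<exists>t0\<in>{0<..<c}. specialisation N D star (complex_of_real t0) \<cong>\<^sub>a B) \<and>
       (\<forall>\<epsilon>>0. \<exists>s. 0 < s \<and> s < \<epsilon> \<and> s < c \<and> specialisation N D star (complex_of_real s) \<cong>\<^sub>a B))"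

lemma star_basis:
  assumes "alg_basis N D"
  shows "star (fps_const a) (fps_const b) =
    (\<Sum>c\<in>D. fps_act N (structure_series N D star a b c) (fps_const c))"
proof (rule fps_ext)
  fix k
  interpret finite_dimensional_vector_space "alg_scale N" D
    using assms by (simp add: alg_basis_def)
  have act: "fps_nth (fps_act N p (fps_const c)) k = alg_scale N (fps_nth p k) c" for p c
  proof -
    have "fps_nth (fps_act N p (fps_const c)) k =
        (\<Sum>i\<le>k. if i = k then alg_scale N (fps_nth p k) c else 0)"
      unfolding fps_act_def fps_nth_Abs_fps by (rule sum.cong) auto
    then show ?thesis by simp
  qed
  have "fps_nth (star (fps_const a) (fps_const b)) k =
      (\<Sum>c\<in>D. alg_scale N (representation D (fps_nth (star (fps_const a) (fps_const b)) k) c) c)"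
    by (rule sum_representation_eq[symmetric])
       (use independent_Basis finite_Basis span_Basis in auto)
  then show "fps_nth (star (fps_const a) (fps_const b)) k =
      fps_nth (\<Sum>c\<in>D. fps_act N (structure_series N D star a b c) (fps_const c)) k"
    by (simp add: fps_sum_nth act structure_series_def)
qed

lemma specialisation_0:
  assumes "formal_deformation N star" "alg_basis N D"
  shows "specialisation N D star 0 = N"
proof -
  interpret formal_deformation N star by fact
  interpret B: finite_dimensional_vector_space "alg_scale N" D
    using assms(2) by (simp add: alg_basis_def)
  have rep: "(\<Sum>c\<in>D. alg_scale N (representation D v c) c) = v" for v
    by (rule sum_representation_eq) (use B.independent_Basis B.finite_Basis B.span_Basis in auto)
  have inner: "(\<Sum>c\<in>D. alg_scale N (eval_fps (structure_series N D star a b c) 0) c) = alg_mult N a b"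
    for a b
    by (simp add: eval_fps_at_0 structure_series_def star_const_term rep)
  have "alg_mult N x y = (\<Sum>a\<in>D. \<Sum>b\<in>D. alg_scale N (representation D x a * representation D y b)
       (alg_mult N a b))" for x y
  proof -
    interpret L: Vector_Spaces.linear "alg_scale N" "alg_scale N" "\<lambda>x. alg_mult N x y"
      by (rule mult_linear_left)
    have R: "alg_mult N a y = (\<Sum>b\<in>D. alg_scale N (representation D y b) (alg_mult N a b))" for a
    proof -
      interpret R: Vector_Spaces.linear "alg_scale N" "alg_scale N" "\<lambda>y. alg_mult N a y"
        by (rule mult_linear_right)
      have "alg_mult N a y = alg_mult N a (\<Sum>b\<in>D. alg_scale N (representation D y b) b)"
        by (simp add: rep)
      then show ?thesis by (simp add: R.sum R.scale)
    qed
    have "alg_mult N x y = alg_mult N (\<Sum>a\<in>D. alg_scale N (representation D x a) a) y"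
      by (simp add: rep)
    also have "\<dots> = (\<Sum>a\<in>D. alg_scale N (representation D x a) (alg_mult N a y))"
      by (simp add: L.sum L.scale)
    finally show ?thesis by (simp add: R scale_sum_right)
  qed
  then have "(\<lambda>x y. \<Sum>a\<in>D. \<Sum>b\<in>D. alg_scale N
      (representation D x a * representation D y b) (alg_mult N a b)) = alg_mult N"
    by (intro ext) (rule sym)
  then have "specialisation N D star 0 = N\<lparr>alg_mult := alg_mult N\<rparr>"
    unfolding specialisation_def inner by (rule arg_cong)
  then show ?thesis by simp
qed

end

theory Submission
  imports Defs "HOL-Complex_Analysis.Complex_Analysis" "Jordan_Normal_Form.Determinant"
begin

text \<open>The structure series converge on a complex disc about 0 that contains both parameters \<open>tA\<close> and
  \<open>tB\<close> with fibres isomorphic to \<open>A\<close> and \<open>B\<close>. So there is an algebra (the fibre) for every complex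
  parameter \<open>z\<close> in this disc. Each fibre carries its trace form, the trace of left multiplication by
  \<open>x y\<close>, and the determinant \<open>\<Delta> z\<close> of its Gram matrix is a holomorphic function of \<open>z\<close>.

  Two facts relate \<open>\<Delta>\<close> to the fibres. First, the trace form of a semisimple algebra is
  nondegenerate, so that \<open>\<Delta>\<close> does not vanish at \<open>tA\<close> and \<open>tB\<close>
  (\<open>trace_form_nondegenerate_if_semisimple\<close>). Secondly, where \<open>\<Delta>\<close> does not vanish the isomorphism
  type of the fibre is locally constant (\<open>fibre_rigid\<close>). To see this, note that the derivative of
  the multiplication in \<open>z\<close> is a Hochschild 2-cocycle. A nondegenerate trace form gives dual bases,
  these give a separability idempotent, and contraction with it writes the cocycle as the coboundary
  of an explicit linear map \<open>h\<close> that is holomorphic in \<open>z\<close> (\<open>cocycle_is_coboundary\<close>). The solution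
  of the linear differential equation \<open>\<phi>' = h \<phi>\<close> that starts with the identity at \<open>z0\<close> then consists
  of isomorphisms from the fibre at \<open>z0\<close> to the fibres at nearby points
  (\<open>structure_constants_transport\<close>).

  Since \<open>\<Delta>\<close> is not identically zero, its zeros are countable, and a disc without a countable set is
  connected. Hence all fibres off the zeros are isomorphic to each other, in particular those at
  \<open>tA\<close> and \<open>tB\<close>. As every interval \<open>(0, \<epsilon>)\<close> is uncountable, it contains parameters off the zeros,
  and their fibres are isomorphic to \<open>A\<close> as well: the deformation is strongly flat.\<close>

section \<open>Endomorphisms in coordinates\<close>

locale based_space = finite_dimensional_vector_space scale D
  for scale :: "complex \<Rightarrow> 'b::ab_group_add \<Rightarrow> 'b" and D :: "'b set"
begin

abbreviation coord :: "'b \<Rightarrow> 'b \<Rightarrow> complex" where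
  "coord \<equiv> representation D"

lemma coord_simps:
  "coord (x + y) d = coord x d + coord y d"
  "coord (scale k x) d = k * coord x d"
  "coord (sum f I) d = (\<Sum>i\<in>I. coord (f i) d)"
  using independent_Basis span_Basis
  by (auto simp: representation_add representation_scale representation_sum)

lemma coord_Basis: "b \<in> D \<Longrightarrow> coord b d = (if d = b then 1 else 0)"
  by (simp add: representation_basis[OF independent_Basis])

lemma sum_coord: "(\<Sum>d\<in>D. scale (coord x d) d) = x"
  by (rule sum_representation_eq) (use independent_Basis finite_Basis span_Basis in auto)

lemma coord_eqI: "(\<And>d. d \<in> D \<Longrightarrow> coord x d = coord y d) \<Longrightarrow> x = y"
  using sum_coord[of x] sum_coord[of y] by (metis (no_types, lifting) sum.cong)

lemma coord_sum_Basis: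
  assumes "c \<in> D"
  shows "coord (\<Sum>d\<in>D. scale (u d) d) c = u c"
proof -
  have "coord (\<Sum>d\<in>D. scale (u d) d) c = (\<Sum>d\<in>D. if d = c then u d else 0)"
    unfolding coord_simps by (rule sum.cong) (auto simp: coord_Basis)
  then show ?thesis using assms finite_Basis by simp
qed

lemma linear_endoI:
  assumes "\<And>x y. f (x + y) = f x + f y" and "\<And>k x. f (scale k x) = scale k (f x)"
  shows "Vector_Spaces.linear scale scale f"
  using assms vector_space_axioms by (simp add: Vector_Spaces.linear_iff)

lemma linear_endo_simps:
  assumes "Vector_Spaces.linear scale scale f"
  shows "f (x + y) = f x + f y" "f (scale k x) = scale k (f x)" "f (sum h I) = (\<Sum>i\<in>I. f (h i))"
proof -
  interpret f: Vector_Spaces.linear scale scale f by fact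
  show "f (x + y) = f x + f y" "f (scale k x) = scale k (f x)" "f (sum h I) = (\<Sum>i\<in>I. f (h i))"
    by (simp_all add: f.add f.scale f.sum)
qed

lemma linear_endo_expand:
  assumes "Vector_Spaces.linear scale scale f"
  shows "f x = (\<Sum>d\<in>D. scale (coord x d) (f d))"
  using linear_endo_simps(3)[OF assms, of "\<lambda>d. scale (coord x d) d" D]
  by (simp add: sum_coord linear_endo_simps(2)[OF assms])

lemma linear_endo_eqI:
  assumes "Vector_Spaces.linear scale scale f" "Vector_Spaces.linear scale scale g"
    and "\<And>d. d \<in> D \<Longrightarrow> f d = g d"
  shows "f x = g x"
  unfolding linear_endo_expand[OF assms(1), of x] linear_endo_expand[OF assms(2), of x]
  using assms(3) by simp

text \<open>Row \<open>a\<close> of the matrix holds the coordinates of the image of \<open>a\<close>, so the composition \<open>\<psi> \<circ> \<phi>\<close> has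
  the product of the matrix of \<open>\<phi>\<close> with that of \<open>\<psi>\<close>, in this order.\<close>

definition linear_ext :: "('b \<Rightarrow> 'b \<Rightarrow> complex) \<Rightarrow> 'b \<Rightarrow> 'b" where
  "linear_ext P x = (\<Sum>k\<in>D. scale (\<Sum>a\<in>D. coord x a * P a k) k)"

lemma linear_linear_ext: "Vector_Spaces.linear scale scale (linear_ext P)"
  by (rule linear_endoI)
     (simp_all add: linear_ext_def coord_simps distrib_right sum.distrib scale_left_distrib
        scale_sum_right sum_distrib_left mult.assoc)

lemma coord_linear_ext: "c \<in> D \<Longrightarrow> coord (linear_ext P x) c = (\<Sum>a\<in>D. coord x a * P a c)"
  by (simp add: linear_ext_def coord_sum_Basis)

lemma linear_ext_Basis:
  assumes "a \<in> D"
  shows "linear_ext P a = (\<Sum>k\<in>D. scale (P a k) k)"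
proof -
  have "(\<Sum>b\<in>D. coord a b * P b k) = (\<Sum>b\<in>D. if b = a then P a k else 0)" for k
    using assms by (intro sum.cong) (auto simp: coord_Basis)
  then show ?thesis using assms finite_Basis by (simp add: linear_ext_def)
qed

definition bilinear_ext :: "('b \<Rightarrow> 'b \<Rightarrow> 'b \<Rightarrow> complex) \<Rightarrow> 'b \<Rightarrow> 'b \<Rightarrow> 'b" where
  "bilinear_ext F x y = (\<Sum>a\<in>D. \<Sum>b\<in>D. scale (coord x a * coord y b) (\<Sum>c\<in>D. scale (F a b c) c))"

lemma linear_bilinear_ext:
  "Vector_Spaces.linear scale scale (\<lambda>x. bilinear_ext F x y)"
  "Vector_Spaces.linear scale scale (bilinear_ext F x)"
  by (rule linear_endoI; simp add: bilinear_ext_def coord_simps distrib_left distrib_right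
        scale_left_distrib sum.distrib scale_sum_right mult_ac)+

lemma bilinear_ext_Basis:
  assumes "a \<in> D" "b \<in> D"
  shows "bilinear_ext F a b = (\<Sum>c\<in>D. scale (F a b c) c)"
proof -
  have "bilinear_ext F a b =
      (\<Sum>a'\<in>D. if a' = a then (\<Sum>b'\<in>D. if b' = b then (\<Sum>c\<in>D. scale (F a b c) c) else 0) else 0)"
    unfolding bilinear_ext_def using assms
    by (intro sum.cong) (auto simp: coord_Basis intro!: sum.cong)
  then show ?thesis using assms finite_Basis by simp
qed

lemma coord_bilinear_ext_Basis:
  "a \<in> D \<Longrightarrow> b \<in> D \<Longrightarrow> c \<in> D \<Longrightarrow> coord (bilinear_ext F a b) c = F a b c"
  by (simp add: bilinear_ext_Basis coord_sum_Basis)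

definition lin_trace :: "('b \<Rightarrow> 'b) \<Rightarrow> complex" where
  "lin_trace f = (\<Sum>d\<in>D. coord (f d) d)"

lemma lin_trace_simps:
  "lin_trace (\<lambda>x. f x + g x) = lin_trace f + lin_trace g"
  "lin_trace (\<lambda>x. scale k (f x)) = k * lin_trace f"
  by (simp_all add: lin_trace_def coord_simps sum.distrib sum_distrib_left)

lemma lin_trace_commute:
  assumes f: "Vector_Spaces.linear scale scale f" and g: "Vector_Spaces.linear scale scale g"
  shows "lin_trace (\<lambda>x. f (g x)) = lin_trace (\<lambda>x. g (f x))"
proof -
  have "lin_trace (\<lambda>x. f (g x)) = (\<Sum>d\<in>D. \<Sum>e\<in>D. coord (g d) e * coord (f e) d)"
    unfolding lin_trace_def
    by (rule sum.cong[OF refl]) (subst linear_endo_expand[OF f], simp add: coord_simps)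
  also have "\<dots> = (\<Sum>e\<in>D. \<Sum>d\<in>D. coord (g d) e * coord (f e) d)"
    by (rule sum.swap)
  also have "\<dots> = lin_trace (\<lambda>x. g (f x))"
    unfolding lin_trace_def
    by (rule sum.cong[OF refl]) (subst linear_endo_expand[OF g], simp add: coord_simps mult.commute)
  finally show ?thesis .
qed

text \<open>An idempotent is the identity on its image, so its trace, computed through a basis \<open>B\<close> of the
  image, is the number of elements of \<open>B\<close>. In characteristic zero trace zero therefore means rank
  zero.\<close>

lemma trace_zero_idempotent:
  fixes p :: "'b \<Rightarrow> 'b"
  assumes p: "Vector_Spaces.linear scale scale p" and idem: "\<And>x. p (p x) = p x"
    and trace: "lin_trace p = 0"
  shows "p x = 0"
proof -
  obtain B where B: "B \<subseteq> range p" "independent B" "range p \<subseteq> span B"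
    using maximal_independent_subset[of "range p"] by metis
  have finB: "finite B" by (rule finiteI_independent[OF B(2)])
  define w where "w v x = representation B (p x) v" for v x
  have inB: "p x \<in> span B" for x using B(3) by auto
  have p_eq: "p x = (\<Sum>v\<in>B. scale (w v x) v)" for x
    unfolding w_def by (rule sum_representation_eq[symmetric]) (use B finB inB in auto)
  have w_lin: "w v x = (\<Sum>d\<in>D. coord x d * w v d)" for v x
    unfolding w_def linear_endo_expand[OF p, of x]
    by (simp add: representation_sum representation_scale B(2) inB span_scale)
  have wB: "w v v = 1" if "v \<in> B" for v
  proof -
    have "p v = v" using that B(1) idem by auto
    then show ?thesis using that by (simp add: w_def representation_basis[OF B(2)])
  qed
  have "lin_trace p = (\<Sum>d\<in>D. \<Sum>v\<in>B. w v d * coord v d)"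
    unfolding lin_trace_def by (subst p_eq) (simp add: coord_simps)
  also have "\<dots> = (\<Sum>v\<in>B. \<Sum>d\<in>D. coord v d * w v d)"
    by (subst sum.swap) (simp add: mult.commute)
  also have "\<dots> = (\<Sum>v\<in>B. 1)"
    by (rule sum.cong[OF refl]) (simp add: w_lin[symmetric] wB)
  finally have "card B = 0"
    using trace by simp
  then show ?thesis
    using p_eq[of x] finB by simp
qed

end

section \<open>Algebras with a basis and their isomorphisms\<close>

locale based_algebra = complex_algebra A + based_space "alg_scale A" D
  for A :: "'a::ab_group_add alg" and D :: "'a set"
begin

abbreviation mul :: "'a \<Rightarrow> 'a \<Rightarrow> 'a" (infixl "\<odot>" 70) where
  "x \<odot> y \<equiv> alg_mult A x y"

lemmas mul_right = linear_endo_simps[OF mult_linear_right]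
lemmas mul_left = linear_endo_simps[OF mult_linear_left]
lemmas mul_simps = mul_right mul_left

end

text \<open>The algebra axioms are multilinear, so it suffices that the structure constants satisfy them on
  basis elements. Below this turns identities between power series into algebras.\<close>

lemma (in based_space) based_algebra_bilinear_ext:
  fixes N :: "'b alg"
  assumes N: "alg_scale N = scale"
    and assoc: "\<And>a b c e. a \<in> D \<Longrightarrow> b \<in> D \<Longrightarrow> c \<in> D \<Longrightarrow> e \<in> D \<Longrightarrow>
      (\<Sum>d\<in>D. g a b d * g d c e) = (\<Sum>d\<in>D. g b c d * g a d e)"
    and one_left: "\<And>b c. b \<in> D \<Longrightarrow> c \<in> D \<Longrightarrow>
      (\<Sum>a\<in>D. coord (alg_one N) a * g a b c) = (if c = b then 1 else 0)"
    and one_right: "\<And>b c. b \<in> D \<Longrightarrow> c \<in> D \<Longrightarrow>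
      (\<Sum>a\<in>D. coord (alg_one N) a * g b a c) = (if c = b then 1 else 0)"
  shows "based_algebra (N\<lparr>alg_mult := bilinear_ext g\<rparr>) D"
proof -
  define m where "m = bilinear_ext g"
  note lin = linear_bilinear_ext[of g, folded m_def]
  note simps = linear_endo_simps[OF lin(1)] linear_endo_simps[OF lin(2)]
  note mB = bilinear_ext_Basis[of _ _ g, folded m_def]
    and coord_m = coord_bilinear_ext_Basis[of _ _ _ g, folded m_def]
  have assoc_Basis: "m (m a b) c = m a (m b c)" if abc: "a \<in> D" "b \<in> D" "c \<in> D" for a b c
  proof (rule coord_eqI)
    fix e assume e: "e \<in> D"
    have "coord (m (m a b) c) e = (\<Sum>d\<in>D. g a b d * g d c e)"
      using abc e by (simp add: mB[OF abc(1,2)] simps coord_simps coord_m)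
    moreover have "coord (m a (m b c)) e = (\<Sum>d\<in>D. g b c d * g a d e)"
      using abc e by (simp add: mB[OF abc(2,3)] simps coord_simps coord_m)
    ultimately show "coord (m (m a b) c) e = coord (m a (m b c)) e"
      using assoc[OF abc e] by simp
  qed
  have assoc2: "m (m a b) z = m a (m b z)" if "a \<in> D" "b \<in> D" for a b z
    by (rule linear_endo_eqI[where f = "\<lambda>z. m (m a b) z"])
       (use that in \<open>auto intro!: linear_endoI simp: simps assoc_Basis\<close>)
  have assoc1: "m (m a y) z = m a (m y z)" if "a \<in> D" for a y z
    by (rule linear_endo_eqI[where f = "\<lambda>y. m (m a y) z"])
       (use that in \<open>auto intro!: linear_endoI simp: simps assoc2\<close>)
  have assoc0: "m (m x y) z = m x (m y z)" for x y z
    by (rule linear_endo_eqI[where f = "\<lambda>x. m (m x y) z"])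
       (auto intro!: linear_endoI simp: simps assoc1)
  have one_left': "m (alg_one N) x = x" for x
  proof (rule linear_endo_eqI[where f = "m (alg_one N)"])
    fix b assume b: "b \<in> D"
    show "m (alg_one N) b = b"
    proof (rule coord_eqI)
      fix c assume "c \<in> D"
      with b show "coord (m (alg_one N) b) c = coord b c"
        by (simp add: linear_endo_expand[OF lin(1), of "alg_one N"] coord_simps coord_m one_left coord_Basis)
    qed
  qed (rule linear_endoI; simp add: simps)+
  have one_right': "m x (alg_one N) = x" for x
  proof (rule linear_endo_eqI[where f = "\<lambda>x. m x (alg_one N)"])
    fix b assume b: "b \<in> D"
    show "m b (alg_one N) = b"
    proof (rule coord_eqI)
      fix c assume "c \<in> D"
      with b show "coord (m b (alg_one N)) c = coord b c"
        by (simp add: linear_endo_expand[OF lin(2), of _ "alg_one N"] coord_simps coord_m one_right coord_Basis)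
    qed
  qed (rule linear_endoI; simp add: simps)+
  have "complex_algebra (N\<lparr>alg_mult := m\<rparr>)"
    using vector_space_axioms lin assoc0 one_left' one_right'
    by (simp add: complex_algebra_def complex_algebra_axioms_def N)
  then show ?thesis
    using based_space_axioms by (simp add: based_algebra_def N m_def)
qed

lemma alg_iso_sym:
  assumes "A \<cong>\<^sub>a B"
  shows "B \<cong>\<^sub>a A"
proof -
  obtain f where f: "bij f" "Vector_Spaces.linear (alg_scale A) (alg_scale B) f"
    "\<And>x y. f (alg_mult A x y) = alg_mult B (f x) (f y)" "f (alg_one A) = alg_one B"
    using assms by (auto simp: alg_iso_def)
  define g where "g = inv_into UNIV f"
  have fg: "f (g y) = y" and gf: "g (f x) = x" for x y
    using f(1) by (auto simp: g_def bij_is_surj surj_f_inv_f bij_is_inj inv_f_f)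
  have "bij g" using f(1) by (simp add: g_def bij_imp_bij_inv)
  moreover have "Vector_Spaces.linear (alg_scale B) (alg_scale A) g"
    using f(2) unfolding Vector_Spaces.linear_iff by (metis fg gf)
  moreover have "g (alg_mult B x y) = alg_mult A (g x) (g y)" for x y
    by (metis f(3) fg gf)
  moreover have "g (alg_one B) = alg_one A"
    by (metis f(4) gf)
  ultimately show ?thesis unfolding alg_iso_def by blast
qed

lemma alg_iso_trans:
  assumes "A \<cong>\<^sub>a B" and "B \<cong>\<^sub>a C"
  shows "A \<cong>\<^sub>a C"
proof -
  obtain f where f: "bij f" "Vector_Spaces.linear (alg_scale A) (alg_scale B) f"
    "\<forall>x y. f (alg_mult A x y) = alg_mult B (f x) (f y)" "f (alg_one A) = alg_one B"
    using assms(1) by (auto simp: alg_iso_def)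
  obtain g where g: "bij g" "Vector_Spaces.linear (alg_scale B) (alg_scale C) g"
    "\<forall>x y. g (alg_mult B x y) = alg_mult C (g x) (g y)" "g (alg_one B) = alg_one C"
    using assms(2) by (auto simp: alg_iso_def)
  have "Vector_Spaces.linear (alg_scale A) (alg_scale C) (g \<circ> f)"
    using f(2) g(2) by (simp add: Vector_Spaces.linear_iff)
  then show ?thesis
    unfolding alg_iso_def using f g by (intro exI[of _ "g \<circ> f"]) (simp add: bij_comp)
qed

lemma semisimple_if_alg_iso:
  assumes "A \<cong>\<^sub>a B" and B: "semisimple_algebra B"
  shows "semisimple_algebra A"
  unfolding semisimple_algebra_def
proof (intro allI impI)
  fix I assume I: "left_ideal A I"
  obtain f where f: "bij f" "Vector_Spaces.linear (alg_scale A) (alg_scale B) f"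
    "\<And>x y. f (alg_mult A x y) = alg_mult B (f x) (f y)"
    using assms(1) by (auto simp: alg_iso_def)
  interpret f: Vector_Spaces.linear "alg_scale A" "alg_scale B" f by fact
  have inj: "x = y" if "f x = f y" for x y using f(1) that by (simp add: bij_def inj_eq)
  have surj: "\<exists>x. y = f x" for y using f(1) by (metis bij_def surjD)
  have "alg_mult B b y \<in> f ` I" if "y \<in> f ` I" for b y
  proof -
    obtain a where "b = f a" using surj by blast
    then show ?thesis using that I by (auto simp: left_ideal_def f(3)[symmetric])
  qed
  then have "left_ideal B (f ` I)"
    using I by (auto simp: left_ideal_def f.subspace_image)
  then obtain J where J: "left_ideal B J" "f ` I \<inter> J = {0}" "\<And>y. \<exists>i\<in>f ` I. \<exists>j\<in>J. y = i + j"
    using B by (metis semisimple_algebra_def)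
  have "left_ideal A (f -` J)"
    using J(1) by (auto simp: left_ideal_def f.subspace_vimage f(3))
  moreover have "I \<inter> f -` J = {0}"
  proof (intro equalityI subsetI)
    fix x assume "x \<in> I \<inter> f -` J"
    then have "f x = 0" using J(2) by blast
    then show "x \<in> {0}" using inj[of x 0] by (simp add: f.zero)
  next
    fix x assume "x \<in> {0 :: 'a}"
    then show "x \<in> I \<inter> f -` J"
      using I J(1) f.vs1.subspace_0 f.vs2.subspace_0 by (auto simp: left_ideal_def f.zero)
  qed
  moreover have "\<exists>i\<in>I. \<exists>j\<in>f -` J. x = i + j" for x
  proof -
    obtain i j where ij: "i \<in> I" "j \<in> J" "f x = f i + j" using J(3)[of "f x"] by auto
    obtain j' where "j = f j'" using surj by blast
    with ij have "x = i + j'" "j' \<in> f -` J" by (auto intro: inj simp: f.add)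
    with ij(1) show ?thesis by blast
  qed
  ultimately show "\<exists>J. left_ideal A J \<and> I \<inter> J = {0} \<and> (\<forall>x. \<exists>i\<in>I. \<exists>j\<in>J. x = i + j)"
    by blast
qed

text \<open>The matrices \<open>P\<close> and \<open>Q\<close> describe maps \<open>\<phi>\<close> and \<open>\<psi>\<close> with \<open>\<psi> \<circ> \<phi> = id\<close>, and the last hypothesis
  says that \<open>\<psi>\<close> takes the product of \<open>\<phi> a\<close> and \<open>\<phi> b\<close> in \<open>A'\<close> back to the product in \<open>A\<close>. In finite
  dimension a one-sided inverse is two-sided, so \<open>\<phi>\<close> is a bijection and multiplicative; being
  surjective and multiplicative, it takes the identity to an identity.\<close>

lemma alg_iso_if_coordinate_iso:
  assumes A: "based_algebra A D" and A': "based_algebra A' D" and scale: "alg_scale A' = alg_scale A"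
  defines "coord \<equiv> module.representation (alg_scale A) D"
  assumes PQ: "\<And>a b. a \<in> D \<Longrightarrow> b \<in> D \<Longrightarrow> (\<Sum>k\<in>D. P a k * Q k b) = (if a = b then 1 else 0)"
    and hom: "\<And>a b c. a \<in> D \<Longrightarrow> b \<in> D \<Longrightarrow> c \<in> D \<Longrightarrow>
      (\<Sum>f\<in>D. (\<Sum>d\<in>D. \<Sum>e\<in>D. P a d * P b e * coord (alg_mult A' d e) f) * Q f c) =
      coord (alg_mult A a b) c"
  shows "A \<cong>\<^sub>a A'"
proof -
  interpret A: based_algebra A D by fact
  interpret A': based_algebra A' D rewrites "alg_scale A' = alg_scale A" by (fact A' scale)+
  define \<phi> where "\<phi> = A.linear_ext P"
  define \<psi> where "\<psi> = A.linear_ext Q"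
  note \<phi> = A.linear_linear_ext[of P, folded \<phi>_def]
  note \<psi> = A.linear_linear_ext[of Q, folded \<psi>_def]
  note lin = A.linear_endo_simps[OF \<phi>] A.linear_endo_simps[OF \<psi>]
  have \<psi>\<phi>: "\<psi> (\<phi> x) = x" for x
  proof (rule A.linear_endo_eqI[where f = "\<lambda>x. \<psi> (\<phi> x)"])
    fix a assume a: "a \<in> D"
    show "\<psi> (\<phi> a) = a"
    proof (rule A.coord_eqI)
      fix b assume b: "b \<in> D"
      have "A.coord (\<psi> (\<phi> a)) b = (\<Sum>k\<in>D. P a k * Q k b)"
        using a b by (simp add: \<psi>_def \<phi>_def A.coord_linear_ext A.linear_ext_Basis A.coord_sum_Basis)
      then show "A.coord (\<psi> (\<phi> a)) b = A.coord a b"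
        using a b by (simp add: PQ A.coord_Basis)
    qed
  qed (rule A.linear_endoI; simp add: lin)+
  then have "inj \<phi>" by (metis injI)
  then have bij: "bij \<phi>"
    using A.linear_inj_imp_surj[OF \<phi>] by (simp add: bij_def)
  then have \<phi>\<psi>: "\<phi> (\<psi> x) = x" for x by (metis \<psi>\<phi> bij_pointE)
  have hom_Basis: "\<psi> (alg_mult A' (\<phi> a) (\<phi> b)) = alg_mult A a b" if ab: "a \<in> D" "b \<in> D" for a b
  proof (rule A.coord_eqI)
    fix c assume c: "c \<in> D"
    have "alg_mult A' (\<phi> a) (\<phi> b) =
        (\<Sum>d\<in>D. \<Sum>e\<in>D. alg_scale A (P a d * P b e) (alg_mult A' d e))"
      using ab by (subst sum.swap) (simp add: \<phi>_def A.linear_ext_Basis A'.mul_simps A.scale_sum_right mult.commute)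
    then have "A.coord (alg_mult A' (\<phi> a) (\<phi> b)) f =
        (\<Sum>d\<in>D. \<Sum>e\<in>D. P a d * P b e * coord (alg_mult A' d e) f)" for f
      by (simp add: A.coord_simps coord_def)
    then show "A.coord (\<psi> (alg_mult A' (\<phi> a) (\<phi> b))) c = A.coord (alg_mult A a b) c"
      using hom[OF ab c] c by (simp add: \<psi>_def A.coord_linear_ext coord_def)
  qed
  have "\<psi> (alg_mult A' (\<phi> x) (\<phi> y)) = alg_mult A x y" for x y
  proof (rule A.linear_endo_eqI[where f = "\<lambda>x. \<psi> (alg_mult A' (\<phi> x) (\<phi> y))"])
    fix a assume a: "a \<in> D"
    show "\<psi> (alg_mult A' (\<phi> a) (\<phi> y)) = alg_mult A a y"
      by (rule A.linear_endo_eqI[where f = "\<lambda>y. \<psi> (alg_mult A' (\<phi> a) (\<phi> y))"];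
          (rule A.linear_endoI)?; simp add: a hom_Basis lin A.mul_simps A'.mul_simps)
  qed (rule A.linear_endoI; simp add: lin A.mul_simps A'.mul_simps)+
  then have mult: "\<phi> (alg_mult A x y) = alg_mult A' (\<phi> x) (\<phi> y)" for x y
    by (metis \<phi>\<psi>)
  have "alg_mult A' (\<phi> (alg_one A)) y = y" for y
    by (metis mult \<phi>\<psi> A.mult_one_left)
  then have one: "\<phi> (alg_one A) = alg_one A'"
    by (metis A'.mult_one_right)
  show ?thesis
    unfolding alg_iso_def scale using bij \<phi> mult one by blast
qed

section \<open>The trace form and the vanishing of second cohomology\<close>

context based_algebra
begin

definition trace_form :: "'a \<Rightarrow> 'a \<Rightarrow> complex" where
  "trace_form x y = lin_trace (\<lambda>v. x \<odot> y \<odot> v)"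

lemma trace_form_left_simps:
  "trace_form (x + x') y = trace_form x y + trace_form x' y"
  "trace_form (alg_scale A k x) y = k * trace_form x y"
  by (simp_all add: trace_form_def mul_simps lin_trace_simps)

lemma trace_form_commute: "trace_form x y = trace_form y x"
  using lin_trace_commute[OF mult_linear_right mult_linear_right, of x y]
  by (simp add: trace_form_def mult_assoc)

lemma trace_form_right_simps:
  "trace_form y (x + x') = trace_form y x + trace_form y x'"
  "trace_form y (alg_scale A k x) = k * trace_form y x"
  by (simp_all add: trace_form_commute[of y] trace_form_left_simps)

lemma trace_form_sum:
  "trace_form (sum f I) y = (\<Sum>i\<in>I. trace_form (f i) y)"
  "trace_form y (sum f I) = (\<Sum>i\<in>I. trace_form y (f i))"
proof -
  have 0: "trace_form 0 y = 0" for y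
    using trace_form_left_simps(2)[of 0 0 y] by simp
  show 1: "trace_form (sum f I) y = (\<Sum>i\<in>I. trace_form (f i) y)" for y
    by (induction I rule: infinite_finite_induct) (auto simp: trace_form_left_simps 0)
  show "trace_form y (sum f I) = (\<Sum>i\<in>I. trace_form y (f i))"
    using 1[of y] by (simp add: trace_form_commute)
qed

lemma trace_form_assoc: "trace_form (x \<odot> y) z = trace_form x (y \<odot> z)"
  by (simp add: trace_form_def mult_assoc)

text \<open>The radical \<open>R\<close> of the trace form is a left ideal. If it has a complementary left ideal, the
  identity splits as \<open>e + f\<close>, and \<open>e \<in> R\<close> is idempotent. Left multiplication by \<open>e\<close> then has trace
  zero because \<open>e\<close> lies in the radical, so \<open>e = 0\<close>. But \<open>e\<close> acts on \<open>R\<close> from the right as the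
  identity, hence \<open>R = 0\<close>.\<close>

lemma trace_form_nondegenerate_if_semisimple:
  assumes "semisimple_algebra A" and x: "\<And>y. trace_form x y = 0"
  shows "x = 0"
proof -
  define R where "R = {x. \<forall>y. trace_form x y = 0}"
  have "trace_form (a \<odot> v) y = 0" if "v \<in> R" for a v y
  proof -
    have "trace_form (a \<odot> v) y = trace_form v (y \<odot> a)"
      by (metis trace_form_assoc trace_form_commute)
    then show ?thesis using that by (simp add: R_def)
  qed
  moreover have "subspace R"
    using trace_form_left_simps(2)[of 0 0]
    by (auto simp: subspace_def R_def trace_form_left_simps)
  ultimately have R: "left_ideal A R"
    by (auto simp: left_ideal_def R_def)
  then obtain J where J: "left_ideal A J" "R \<inter> J = {0}" "\<And>x. \<exists>i\<in>R. \<exists>j\<in>J. x = i + j"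
    using assms(1) by (metis semisimple_algebra_def)
  obtain e f where ef: "e \<in> R" "f \<in> J" "alg_one A = e + f"
    using J(3) by metis
  have split: "y - y \<odot> e = y \<odot> f" for y
    using arg_cong[OF ef(3), of "\<lambda>u. y \<odot> u"] by (simp add: mult_one_right mul_simps algebra_simps)
  have zero: "y \<odot> f = 0" if "y \<in> R" for y
  proof -
    have "y \<odot> e \<in> R" using R ef by (simp add: left_ideal_def)
    then have "y - y \<odot> e \<in> R" using R that by (simp add: left_ideal_def subspace_diff)
    moreover have "y \<odot> f \<in> J" using J(1) ef by (simp add: left_ideal_def)
    ultimately show ?thesis using J(2) split[of y] by auto
  qed
  have idem: "e \<odot> e = e" using split[of e] zero[OF ef(1)] by simp
  have "lin_trace (\<lambda>v. e \<odot> v) = 0"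
    using ef(1) by (auto simp: R_def trace_form_def mult_one_right dest: spec[of _ "alg_one A"])
  then have "e \<odot> alg_one A = 0"
    by (intro trace_zero_idempotent mult_linear_right) (auto simp: mult_assoc[symmetric] idem)
  then have "e = 0" by (simp add: mult_one_right)
  moreover have "x \<in> R" using x by (simp add: R_def)
  ultimately show ?thesis
    using split[of x] zero[of x] mul_right(2)[of x 0 0] by simp
qed

text \<open>From here on \<open>S\<close> is an inverse of the Gram matrix of the trace form. It provides the basis dual to
  \<open>D\<close>, and with it the tensor \<open>\<Sum>a. a \<otimes> dual a\<close>. That tensor is a separability idempotent: it
  commutes with the algebra and multiplies to the identity. Contraction with it is the explicit
  formula by which cocycles become coboundaries.\<close>

context
  fixes S :: "'a \<Rightarrow> 'a \<Rightarrow> complex"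
  assumes S: "\<And>a c. a \<in> D \<Longrightarrow> c \<in> D \<Longrightarrow>
    (\<Sum>b\<in>D. S a b * trace_form b c) = (if a = c then 1 else 0)"
begin

definition dual :: "'a \<Rightarrow> 'a" where
  "dual a = (\<Sum>b\<in>D. alg_scale A (S a b) b)"

lemma trace_form_dual:
  assumes "a \<in> D"
  shows "trace_form (dual a) x = coord x a"
proof -
  have "trace_form (dual a) c = (if a = c then 1 else 0)" if "c \<in> D" for c
    using S[OF assms that] by (simp add: dual_def trace_form_sum trace_form_left_simps)
  then have "trace_form (dual a) (\<Sum>c\<in>D. alg_scale A (coord x c) c) =
      (\<Sum>c\<in>D. if a = c then coord x c else 0)"
    unfolding trace_form_sum trace_form_right_simps by (intro sum.cong) auto
  then show ?thesis using assms finite_Basis by (simp add: sum_coord)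
qed

lemma eq_if_trace_form_eq:
  assumes "\<And>z. trace_form z x = trace_form z y"
  shows "x = y"
  by (rule coord_eqI) (metis assms trace_form_dual)

lemma dual_expand: "x = (\<Sum>a\<in>D. alg_scale A (trace_form a x) (dual a))"
proof (rule eq_if_trace_form_eq)
  fix z
  have "trace_form z (\<Sum>a\<in>D. alg_scale A (trace_form a x) (dual a)) =
      (\<Sum>a\<in>D. coord z a * trace_form a x)"
    unfolding trace_form_sum trace_form_right_simps
    by (rule sum.cong) (auto simp: trace_form_commute[of z] trace_form_dual)
  also have "\<dots> = trace_form (\<Sum>a\<in>D. alg_scale A (coord z a) a) x"
    by (simp add: trace_form_sum trace_form_left_simps)
  finally show "trace_form z x = trace_form z (\<Sum>a\<in>D. alg_scale A (trace_form a x) (dual a))"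
    by (simp add: sum_coord)
qed

text \<open>Expand \<open>y \<odot> a\<close> in the basis \<open>D\<close> and \<open>dual c \<odot> y\<close> in the dual basis: by invariance and symmetry of
  the trace form both expansions have the coefficients \<open>trace_form (dual c) (y \<odot> a)\<close>.\<close>

lemma casimir_central:
  assumes f: "Vector_Spaces.linear (alg_scale A) (alg_scale A) f"
  shows "(\<Sum>a\<in>D. y \<odot> a \<odot> f (dual a)) = (\<Sum>a\<in>D. a \<odot> f (dual a \<odot> y))"
proof -
  have "(\<Sum>a\<in>D. y \<odot> a \<odot> f (dual a)) =
      (\<Sum>a\<in>D. (\<Sum>c\<in>D. alg_scale A (coord (y \<odot> a) c) c) \<odot> f (dual a))"
    by (simp add: sum_coord)
  also have "\<dots> = (\<Sum>a\<in>D. \<Sum>c\<in>D. alg_scale A (coord (y \<odot> a) c) (c \<odot> f (dual a)))"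
    by (simp add: mul_simps)
  also have "\<dots> = (\<Sum>c\<in>D. \<Sum>a\<in>D. alg_scale A (coord (y \<odot> a) c) (c \<odot> f (dual a)))"
    by (rule sum.swap)
  also have "\<dots> = (\<Sum>c\<in>D. c \<odot> f (dual c \<odot> y))"
  proof (rule sum.cong[OF refl])
    fix c assume c: "c \<in> D"
    have "trace_form a (dual c \<odot> y) = coord (y \<odot> a) c" for a
      by (metis trace_form_assoc trace_form_commute trace_form_dual[OF c])
    then have "dual c \<odot> y = (\<Sum>a\<in>D. alg_scale A (coord (y \<odot> a) c) (dual a))"
      using dual_expand[of "dual c \<odot> y"] by simp
    then show "(\<Sum>a\<in>D. alg_scale A (coord (y \<odot> a) c) (c \<odot> f (dual a))) = c \<odot> f (dual c \<odot> y)"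
      by (simp add: linear_endo_simps[OF f] mul_simps)
  qed
  finally show ?thesis .
qed

text \<open>Pairing the left hand side with \<open>z\<close> gives the sum of the diagonal coordinates of left
  multiplication by \<open>z\<close>. That is its trace, which is the pairing of \<open>z\<close> with the identity.\<close>

lemma casimir_product: "(\<Sum>a\<in>D. a \<odot> dual a) = alg_one A"
proof (rule eq_if_trace_form_eq)
  fix z
  have "trace_form z (\<Sum>a\<in>D. a \<odot> dual a) = (\<Sum>a\<in>D. coord (z \<odot> a) a)"
    unfolding trace_form_sum
    by (rule sum.cong[OF refl]) (metis trace_form_assoc trace_form_commute trace_form_dual)
  then show "trace_form z (\<Sum>a\<in>D. a \<odot> dual a) = trace_form z (alg_one A)"
    by (simp add: trace_form_def lin_trace_def mult_one_right)
qed

text \<open>The standard contraction with the separability idempotent: put \<open>x = dual a\<close> in the cocycle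
  identity, multiply by \<open>a\<close> from the left, sum over \<open>a\<close>, and move \<open>y\<close> across the idempotent.\<close>

lemma cocycle_is_coboundary:
  assumes f: "\<And>z. Vector_Spaces.linear (alg_scale A) (alg_scale A) (\<lambda>x. f x z)"
    and cocycle: "\<And>x. x \<odot> f y z + f x (y \<odot> z) = f (x \<odot> y) z + f x y \<odot> z"
  defines "g \<equiv> \<lambda>x. \<Sum>a\<in>D. a \<odot> f (dual a) x"
  shows "f y z + g (y \<odot> z) = y \<odot> g z + g y \<odot> z"
proof -
  have "f y z + g (y \<odot> z) =
      (\<Sum>a\<in>D. a \<odot> dual a) \<odot> f y z + (\<Sum>a\<in>D. a \<odot> f (dual a) (y \<odot> z))"
    by (simp add: casimir_product mult_one_left g_def)
  also have "\<dots> = (\<Sum>a\<in>D. a \<odot> (dual a \<odot> f y z + f (dual a) (y \<odot> z)))"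
    by (simp add: mul_simps sum.distrib mult_assoc)
  also have "\<dots> = (\<Sum>a\<in>D. a \<odot> f (dual a \<odot> y) z) + g y \<odot> z"
    by (simp add: cocycle g_def mul_simps sum.distrib mult_assoc)
  also have "(\<Sum>a\<in>D. a \<odot> f (dual a \<odot> y) z) = y \<odot> g z"
    by (simp add: casimir_central[OF f, symmetric] g_def mul_simps mult_assoc)
  finally show ?thesis .
qed

end

text \<open>The preceding lemma in coordinates, with \<open>H\<close> the matrix of \<open>-g\<close>. The sign is chosen such that
  the conclusion is the infinitesimal form of "the maps \<open>\<phi>\<close> with \<open>\<phi>' = H \<phi>\<close> preserve the
  multiplication" when \<open>F\<close> is the derivative of the multiplication \<open>m\<close>. Moreover \<open>H\<close> is a polynomial
  in \<open>S\<close>, \<open>F\<close> and \<open>m\<close>, hence holomorphic if they are.\<close>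

lemma coboundary_coordinates:
  fixes S :: "'a \<Rightarrow> 'a \<Rightarrow> complex" and F :: "'a \<Rightarrow> 'a \<Rightarrow> 'a \<Rightarrow> complex"
  defines "m \<equiv> \<lambda>a b. coord (a \<odot> b)"
  assumes S: "\<And>a c. a \<in> D \<Longrightarrow> c \<in> D \<Longrightarrow>
      (\<Sum>b\<in>D. S a b * trace_form b c) = (if a = c then 1 else 0)"
    and F: "\<And>a b c e. a \<in> D \<Longrightarrow> b \<in> D \<Longrightarrow> c \<in> D \<Longrightarrow> e \<in> D \<Longrightarrow>
      (\<Sum>d\<in>D. F b c d * m a d e) + (\<Sum>d\<in>D. m b c d * F a d e) =
      (\<Sum>d\<in>D. m a b d * F d c e) + (\<Sum>d\<in>D. F a b d * m d c e)"
  defines "H \<equiv> \<lambda>x c. - (\<Sum>a\<in>D. \<Sum>b\<in>D. \<Sum>d\<in>D. S a b * F b x d * m a d c)"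
  assumes abc: "a \<in> D" "b \<in> D" "c \<in> D"
  shows "(\<Sum>f\<in>D. m a b f * H f c) =
    F a b c + (\<Sum>f\<in>D. H a f * m f b c) + (\<Sum>f\<in>D. H b f * m a f c)"
proof -
  define f where "f = bilinear_ext F"
  define g where "g x = (\<Sum>a\<in>D. a \<odot> f (dual S a) x)" for x
  note f_left = linear_bilinear_ext(1)[of F, folded f_def]
    and f_right = linear_bilinear_ext(2)[of F, folded f_def]
  note f_simps = linear_endo_simps[OF f_left] linear_endo_simps[OF f_right]
  note fB = bilinear_ext_Basis[of _ _ F, folded f_def]
    and coord_f = coord_bilinear_ext_Basis[of _ _ _ F, folded f_def]
  have mB: "a \<odot> b = (\<Sum>d\<in>D. alg_scale A (m a b d) d)" for a b
    by (simp add: m_def sum_coord)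
  have cocycle: "x \<odot> f y z + f x (y \<odot> z) = f (x \<odot> y) z + f x y \<odot> z"
    if yz: "y \<in> D" "z \<in> D" for x y z
  proof (rule linear_endo_eqI[where f = "\<lambda>x. x \<odot> f y z + f x (y \<odot> z)"])
    fix x assume x: "x \<in> D"
    show "x \<odot> f y z + f x (y \<odot> z) = f (x \<odot> y) z + f x y \<odot> z"
    proof (rule coord_eqI)
      fix e assume e: "e \<in> D"
      have "coord (x \<odot> f y z) e = (\<Sum>d\<in>D. F y z d * m x d e)"
        using yz by (simp add: fB mul_simps coord_simps m_def)
      moreover have "coord (f x (y \<odot> z)) e = (\<Sum>d\<in>D. m y z d * F x d e)"
        using x e by (subst mB) (simp add: f_simps coord_simps coord_f)
      moreover have "coord (f (x \<odot> y) z) e = (\<Sum>d\<in>D. m x y d * F d z e)"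
        using yz e by (subst mB) (simp add: f_simps coord_simps coord_f)
      moreover have "coord (f x y \<odot> z) e = (\<Sum>d\<in>D. F x y d * m d z e)"
        using x yz by (simp add: fB mul_simps coord_simps m_def)
      ultimately show "coord (x \<odot> f y z + f x (y \<odot> z)) e = coord (f (x \<odot> y) z + f x y \<odot> z) e"
        using F[OF x yz e] by (simp add: coord_simps)
    qed
  qed (rule linear_endoI; simp add: mul_simps f_simps scale_right_distrib algebra_simps)+
  have H: "coord (g x) c = - H x c" if "x \<in> D" "c \<in> D" for x c
  proof -
    have "coord (a \<odot> f (dual S a) x) c = (\<Sum>b\<in>D. \<Sum>d\<in>D. S a b * F b x d * m a d c)" for a
    proof -
      have "f (dual S a) x = (\<Sum>b\<in>D. alg_scale A (S a b) (\<Sum>d\<in>D. alg_scale A (F b x d) d))"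
        using that by (simp add: dual_def[OF S] f_simps fB)
      then show ?thesis
        by (simp add: mul_simps coord_simps m_def sum_distrib_left mult.assoc)
    qed
    then show ?thesis by (simp add: g_def coord_simps H_def)
  qed
  have g: "Vector_Spaces.linear (alg_scale A) (alg_scale A) g"
    by (rule linear_endoI) (simp_all add: g_def f_simps mul_simps sum.distrib scale_sum_right)
  have g_coord: "coord (g (\<Sum>d\<in>D. alg_scale A (u d) d)) c = - (\<Sum>d\<in>D. u d * H d c)" for u
    using abc by (simp add: linear_endo_simps[OF g] coord_simps H sum_negf)
  have gB: "g x = (\<Sum>d\<in>D. alg_scale A (- H x d) d)" if "x \<in> D" for x
    using that by (intro coord_eqI) (simp add: coord_sum_Basis H del: scale_minus_left)
  have "f a b + g (a \<odot> b) = a \<odot> g b + g a \<odot> b"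
    unfolding g_def by (rule cocycle_is_coboundary[OF S f_left cocycle[OF abc(1,2)]])
  then have "coord (f a b) c + coord (g (a \<odot> b)) c = coord (a \<odot> g b) c + coord (g a \<odot> b) c"
    by (metis coord_simps(1))
  moreover have "coord (g (a \<odot> b)) c = - (\<Sum>f\<in>D. m a b f * H f c)"
    by (subst mB) (rule g_coord)
  moreover have "coord (a \<odot> g b) c = - (\<Sum>f\<in>D. H b f * m a f c)"
    using abc by (simp add: gB mul_simps coord_simps m_def sum_negf del: scale_minus_left)
  moreover have "coord (g a \<odot> b) c = - (\<Sum>f\<in>D. H a f * m f b c)"
    using abc by (simp add: gB mul_simps coord_simps m_def sum_negf del: scale_minus_left)
  ultimately show ?thesis
    using coord_f[OF abc] by (simp add: algebra_simps)
qed

end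

section \<open>Sums of convergent power series and linear differential equations\<close>

lemma fps_conv_radius_sum_ge:
  fixes F :: "'i \<Rightarrow> 'b::{banach, real_normed_div_algebra} fps"
  assumes "\<And>i. i \<in> I \<Longrightarrow> r \<le> fps_conv_radius (F i)"
  shows "r \<le> fps_conv_radius (\<Sum>i\<in>I. F i)"
  using assms
proof (induction I rule: infinite_finite_induct)
  case (insert i I)
  have "r \<le> min (fps_conv_radius (F i)) (fps_conv_radius (sum F I))"
    using insert by (intro min.boundedI) auto
  also have "\<dots> \<le> fps_conv_radius (F i + sum F I)"
    by (rule fps_conv_radius_add)
  finally show ?case
    using insert by simp
qed auto

lemma eval_fps_sum:
  fixes F :: "'i \<Rightarrow> 'b::{banach, real_normed_div_algebra} fps"
  assumes "\<And>i. i \<in> I \<Longrightarrow> ereal (norm z) < fps_conv_radius (F i)"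
  shows "eval_fps (\<Sum>i\<in>I. F i) z = (\<Sum>i\<in>I. eval_fps (F i) z)"
  using assms
proof (induction I rule: infinite_finite_induct)
  case (insert i I)
  have "ereal (norm z) < fps_conv_radius (sum F I)"
  proof (cases "I = {}")
    case False
    have "Min ((\<lambda>i. fps_conv_radius (F i)) ` I) \<le> fps_conv_radius (sum F I)"
      by (rule fps_conv_radius_sum_ge) (use insert in auto)
    moreover have "ereal (norm z) < Min ((\<lambda>i. fps_conv_radius (F i)) ` I)"
      using insert False by simp
    ultimately show ?thesis by order
  qed auto
  then show ?case
    using insert by (simp add: eval_fps_add)
qed auto

lemma eval_fps_sum_mult:
  fixes F G :: "'i \<Rightarrow> complex fps"
  assumes "\<And>i. i \<in> I \<Longrightarrow> ereal (norm z) < fps_conv_radius (F i)"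
    and "\<And>i. i \<in> I \<Longrightarrow> ereal (norm z) < fps_conv_radius (G i)"
  shows "eval_fps (\<Sum>i\<in>I. F i * G i) z = (\<Sum>i\<in>I. eval_fps (F i) z * eval_fps (G i) z)"
proof -
  have "ereal (norm z) < fps_conv_radius (F i * G i)" if "i \<in> I" for i
    by (rule less_le_trans[OF _ fps_conv_radius_mult]) (use assms[OF that] in simp)
  then show ?thesis
    using assms by (simp add: eval_fps_sum eval_fps_mult)
qed

text \<open>The Taylor coefficients of the solution of \<open>P' = P H\<close> that starts at the identity matrix.\<close>

fun ode_coeff :: "'i set \<Rightarrow> ('i \<Rightarrow> 'i \<Rightarrow> complex fps) \<Rightarrow> nat \<Rightarrow> 'i \<Rightarrow> 'i \<Rightarrow> complex" where
  "ode_coeff D H 0 i j = (if i = j then 1 else 0)"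
| "ode_coeff D H (Suc n) i j =
    (\<Sum>m\<le>n. \<Sum>k\<in>D. ode_coeff D H m i k * fps_nth (H k j) (n - m)) / of_nat (Suc n)"

lemma fps_deriv_ode_coeff:
  "fps_deriv (Abs_fps (\<lambda>n. ode_coeff D H n i j)) =
    (\<Sum>k\<in>D. Abs_fps (\<lambda>n. ode_coeff D H n i k) * H k j)"
proof (rule fps_ext)
  fix n
  have "fps_nth (fps_deriv (Abs_fps (\<lambda>n. ode_coeff D H n i j))) n =
      (\<Sum>m\<le>n. \<Sum>k\<in>D. ode_coeff D H m i k * fps_nth (H k j) (n - m))"
    by (simp del: of_nat_Suc)
  also have "\<dots> = (\<Sum>k\<in>D. \<Sum>m\<le>n. ode_coeff D H m i k * fps_nth (H k j) (n - m))"
    by (rule sum.swap)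
  finally show "fps_nth (fps_deriv (Abs_fps (\<lambda>n. ode_coeff D H n i j))) n =
      fps_nth (\<Sum>k\<in>D. Abs_fps (\<lambda>n. ode_coeff D H n i k) * H k j) n"
    by (simp add: fps_sum_nth fps_mult_nth atLeast0AtMost)
qed

text \<open>The Cauchy product that defines the next coefficient has \<open>n + 1\<close> terms, and the division by
  \<open>n + 1\<close> compensates for exactly that. So a geometric bound on \<open>H\<close> passes to the solution, at the
  cost only of enlarging the ratio \<open>R\<close>.\<close>

lemma norm_ode_coeff_le:
  assumes R: "real (card D) * M \<le> R" "1 \<le> R" and M: "0 \<le> M"
    and H: "\<And>i j n. i \<in> D \<Longrightarrow> j \<in> D \<Longrightarrow> norm (fps_nth (H i j) n) \<le> M * R ^ n"
    and "j \<in> D"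
  shows "norm (ode_coeff D H n i j) \<le> R ^ n"
  using \<open>j \<in> D\<close>
proof (induction n arbitrary: j rule: less_induct)
  case (less n)
  show ?case
  proof (cases n)
    case (Suc n')
    have "norm (\<Sum>m\<le>n'. \<Sum>k\<in>D. ode_coeff D H m i k * fps_nth (H k j) (n' - m))
        \<le> (\<Sum>m\<le>n'. \<Sum>k\<in>D. M * R ^ n')"
    proof (intro order_trans[OF norm_sum] sum_mono)
      fix m k assume mk: "m \<in> {..n'}" "k \<in> D"
      have "norm (ode_coeff D H m i k * fps_nth (H k j) (n' - m)) \<le> R ^ m * (M * R ^ (n' - m))"
        unfolding norm_mult using mk less Suc H R by (intro mult_mono) auto
      also have "\<dots> = M * R ^ n'"
        using mk by (simp add: power_add[symmetric])
      finally show "norm (ode_coeff D H m i k * fps_nth (H k j) (n' - m)) \<le> M * R ^ n'" .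
    qed
    also have "\<dots> = real (Suc n') * (real (card D) * M * R ^ n')"
      by simp
    also have "\<dots> \<le> real (Suc n') * (R * R ^ n')"
      using R by (intro mult_left_mono mult_right_mono) auto
    finally show ?thesis
      unfolding Suc ode_coeff.simps norm_divide norm_of_nat
      by (simp add: divide_le_eq mult.commute del: of_nat_Suc)
  qed auto
qed

lemma linear_ode_solution:
  fixes h :: "'i \<Rightarrow> 'i \<Rightarrow> complex \<Rightarrow> complex"
  assumes "finite D" "0 < r"
    and h: "\<forall>i\<in>D. \<forall>j\<in>D. h i j holomorphic_on ball z0 r"
  shows "\<exists>\<rho> P. 0 < \<rho> \<and> \<rho> \<le> r \<and> (\<forall>i j. P i j z0 = (if i = j then 1 else 0)) \<and>
    (\<forall>i\<in>D. \<forall>j\<in>D. \<forall>z\<in>ball z0 \<rho>.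
      (P i j has_field_derivative (\<Sum>k\<in>D. P i k z * h k j z)) (at z))"
proof -
  define H where "H i j = fps_expansion (h i j) z0" for i j
  have hol: "h i j holomorphic_on eball z0 (ereal r)" if "i \<in> D" "j \<in> D" for i j
    using h that by simp
  have Hconv: "ereal r \<le> fps_conv_radius (H i j)" if "i \<in> D" "j \<in> D" for i j
    unfolding H_def by (rule conv_radius_fps_expansion[OF hol[OF that]])
  have Heval: "eval_fps (H i j) (z - z0) = h i j z" if "i \<in> D" "j \<in> D" "z \<in> ball z0 r" for i j z
    unfolding H_def by (rule eval_fps_expansion[OF hol[OF that(1,2)]]) (use that in simp)
  have "\<exists>m\<ge>0. \<forall>n. norm (fps_nth (H i j) n) \<le> m * (2 / r) ^ n" if "i \<in> D" "j \<in> D" for i j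
  proof -
    have "ereal (norm (complex_of_real (r / 2))) < fps_conv_radius (H i j)"
      by (rule less_le_trans[OF _ Hconv[OF that]]) (use \<open>0 < r\<close> in simp)
    then have "summable (\<lambda>n. fps_nth (H i j) n * complex_of_real (r / 2) ^ n)"
      by (rule summable_fps)
    then have "Bseq (\<lambda>n. fps_nth (H i j) n * complex_of_real (r / 2) ^ n)"
      by (rule convergent_imp_Bseq[OF convergentI[OF summable_LIMSEQ_zero]])
    then obtain m where m: "m > 0" "\<And>n. norm (fps_nth (H i j) n * complex_of_real (r / 2) ^ n) \<le> m"
      by (auto simp: Bseq_def)
    have "norm (fps_nth (H i j) n) \<le> m * (2 / r) ^ n" for n
      using m(2)[of n] \<open>0 < r\<close>
      by (simp add: norm_mult norm_power norm_divide power_divide field_simps)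
    then show ?thesis using m(1) by (intro exI[of _ m]) auto
  qed
  then obtain m where m: "\<And>i j. i \<in> D \<Longrightarrow> j \<in> D \<Longrightarrow> 0 \<le> m i j"
      "\<And>i j n. i \<in> D \<Longrightarrow> j \<in> D \<Longrightarrow> norm (fps_nth (H i j) n) \<le> m i j * (2 / r) ^ n"
    by metis
  \<comment> \<open>One bound for all entries of the matrix; the radius is halved above because the series of \<open>h\<close>
    need not converge on the boundary of the disc.\<close>
  define M where "M = (\<Sum>i\<in>D. \<Sum>j\<in>D. m i j)"
  define R where "R = max 1 (max (2 / r) (real (card D) * M))"
  have M0: "0 \<le> M"
    unfolding M_def by (intro sum_nonneg m)
  have HM: "norm (fps_nth (H i j) n) \<le> M * R ^ n" if "i \<in> D" "j \<in> D" for i j n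
  proof -
    have "m i j \<le> (\<Sum>j\<in>D. m i j)"
      using that m assms(1) by (intro member_le_sum) auto
    also have "\<dots> \<le> M"
      unfolding M_def using that m assms(1)
      by (intro member_le_sum[where f = "\<lambda>i. \<Sum>j\<in>D. m i j"] sum_nonneg) auto
    finally have "m i j * (2 / r) ^ n \<le> M * R ^ n"
      using M0 \<open>0 < r\<close> by (intro mult_mono power_mono) (auto simp: R_def)
    with m(2)[OF that, of n] show ?thesis by linarith
  qed
  define F where "F i j = Abs_fps (\<lambda>n. ode_coeff D H n i j)" for i j
  have R1: "1 \<le> R" by (simp add: R_def)
  have Fconv: "ereal (1 / R) \<le> fps_conv_radius (F i j)" if "j \<in> D" for i j
    unfolding fps_conv_radius_def
  proof (rule conv_radius_geI_ex')
    fix s :: real assume s: "0 < s" "ereal s < ereal (1 / R)"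
    then have "\<bar>R * s\<bar> < 1"
      using R1 by (simp add: field_simps)
    then have "summable (\<lambda>n. (R * s) ^ n)"
      by (simp add: summable_geometric)
    then show "summable (\<lambda>n. fps_nth (F i j) n * complex_of_real s ^ n)"
    proof (rule summable_comparison_test')
      fix n
      have "norm (ode_coeff D H n i j) \<le> R ^ n"
        by (rule norm_ode_coeff_le[OF _ R1 M0 HM that]) (simp_all add: R_def)
      then show "norm (fps_nth (F i j) n * complex_of_real s ^ n) \<le> (R * s) ^ n"
        using s by (simp add: F_def norm_mult norm_power power_mult_distrib)
    qed
  qed
  define \<rho> where "\<rho> = min r (1 / R)"
  define P where "P i j z = eval_fps (F i j) (z - z0)" for i j z
  show ?thesis
  proof (intro exI[of _ \<rho>] exI[of _ P] conjI allI ballI)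
    show "0 < \<rho>" "\<rho> \<le> r" using \<open>0 < r\<close> R1 by (auto simp: \<rho>_def)
    show "P i j z0 = (if i = j then 1 else 0)" for i j
      by (simp add: P_def eval_fps_at_0 F_def)
    fix i j z assume ij: "i \<in> D" "j \<in> D" and z: "z \<in> ball z0 \<rho>"
    have zr: "z \<in> ball z0 r" "norm (z - z0) < 1 / R" "norm (z - z0) < r"
      using z by (auto simp: \<rho>_def dist_norm norm_minus_commute)
    have cF: "ereal (norm (z - z0)) < fps_conv_radius (F i k)" if "k \<in> D" for i k
      by (rule less_le_trans[OF _ Fconv[OF that]]) (use zr in simp)
    have cH: "ereal (norm (z - z0)) < fps_conv_radius (H k j)" if "k \<in> D" for k
      by (rule less_le_trans[OF _ Hconv[OF that ij(2)]]) (use zr in simp)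
    have "(P i j has_field_derivative eval_fps (fps_deriv (F i j)) (z - z0) * 1) (at z)"
      unfolding P_def
      by (rule DERIV_chain2[where f = "eval_fps (F i j)"])
         (auto intro!: has_field_derivative_eval_fps cF ij derivative_eq_intros)
    also have "eval_fps (fps_deriv (F i j)) (z - z0) * 1 = (\<Sum>k\<in>D. P i k z * h k j z)"
    proof -
      have "fps_deriv (F i j) = (\<Sum>k\<in>D. F i k * H k j)"
        unfolding F_def by (rule fps_deriv_ode_coeff)
      then show ?thesis
        using cF cH Heval ij zr by (simp add: eval_fps_sum_mult P_def)
    qed
    finally show "(P i j has_field_derivative (\<Sum>k\<in>D. P i k z * h k j z)) (at z)" .
  qed
qed

lemma ball_const_if_deriv_zero:
  fixes f :: "complex \<Rightarrow> complex"
  assumes "\<And>z. z \<in> ball z0 r \<Longrightarrow> (f has_field_derivative 0) (at z)" and "z \<in> ball z0 r"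
  shows "f z = f z0"
proof -
  have "\<exists>c. \<forall>x\<in>ball z0 r. f x = c"
  proof (rule has_field_derivative_zero_constant)
    show "(f has_field_derivative 0) (at x within ball z0 r)" if "x \<in> ball z0 r" for x
      using assms(1)[OF that] by (rule has_field_derivative_at_within)
  qed simp
  moreover have "z0 \<in> ball z0 r"
    using assms(2) by (auto intro: le_less_trans[OF zero_le_dist])
  ultimately show ?thesis using assms(2) by auto
qed

text \<open>The inverse of the solution of \<open>P' = P h\<close> must solve \<open>Q' = - h Q\<close>, which is again an equation of
  the first kind for the transpose of \<open>Q\<close>. Conversely the product of the two solutions has
  derivative \<open>P h Q - P h Q = 0\<close>.\<close>

lemma linear_ode_inverse_pair:
  fixes h :: "'i \<Rightarrow> 'i \<Rightarrow> complex \<Rightarrow> complex"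
  assumes "finite D" "0 < r"
    and h: "\<forall>i\<in>D. \<forall>j\<in>D. h i j holomorphic_on ball z0 r"
  shows "\<exists>\<rho> P Q. 0 < \<rho> \<and> \<rho> \<le> r \<and>
    (\<forall>i j. P i j z0 = (if i = j then 1 else 0)) \<and>
    (\<forall>i j. Q i j z0 = (if i = j then 1 else 0)) \<and>
    (\<forall>i\<in>D. \<forall>j\<in>D. \<forall>z\<in>ball z0 \<rho>.
      (P i j has_field_derivative (\<Sum>k\<in>D. P i k z * h k j z)) (at z) \<and>
      (Q i j has_field_derivative - (\<Sum>k\<in>D. h i k z * Q k j z)) (at z) \<and>
      (\<Sum>k\<in>D. P i k z * Q k j z) = (if i = j then 1 else 0))"
proof -
  obtain \<rho>1 P where P: "0 < \<rho>1" "\<rho>1 \<le> r" "\<forall>i j. P i j z0 = (if i = j then 1 else 0)"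
    "\<forall>i\<in>D. \<forall>j\<in>D. \<forall>z\<in>ball z0 \<rho>1.
      (P i j has_field_derivative (\<Sum>k\<in>D. P i k z * h k j z)) (at z)"
    using linear_ode_solution[OF assms] by (elim exE conjE) (rule that)
  have h': "\<forall>i\<in>D. \<forall>j\<in>D. (\<lambda>z. - h j i z) holomorphic_on ball z0 r"
    using h by (auto intro: holomorphic_on_minus)
  obtain \<rho>2 Q where Q: "0 < \<rho>2" "\<rho>2 \<le> r" "\<forall>i j. Q i j z0 = (if i = j then 1 else 0)"
    "\<forall>i\<in>D. \<forall>j\<in>D. \<forall>z\<in>ball z0 \<rho>2.
      (Q i j has_field_derivative (\<Sum>k\<in>D. Q i k z * - h j k z)) (at z)"
    using linear_ode_solution[where h = "\<lambda>i j z. - h j i z", OF assms(1,2) h']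
    by (elim exE conjE) (rule that)
  define \<rho> where "\<rho> = min \<rho>1 \<rho>2"
  have dP: "(P i j has_field_derivative (\<Sum>k\<in>D. P i k z * h k j z)) (at z)"
    if "i \<in> D" "j \<in> D" "z \<in> ball z0 \<rho>" for i j z
    using P(4) that by (simp add: \<rho>_def)
  have dQ: "(Q j i has_field_derivative - (\<Sum>k\<in>D. h i k z * Q j k z)) (at z)"
    if "i \<in> D" "j \<in> D" "z \<in> ball z0 \<rho>" for i j z
    using Q(4) that by (simp add: \<rho>_def sum_negf mult.commute)
  have inv: "(\<Sum>k\<in>D. P i k z * Q j k z) = (if i = j then 1 else 0)"
    if ij: "i \<in> D" "j \<in> D" and z: "z \<in> ball z0 \<rho>" for i j z
  proof -
    have "((\<lambda>z. \<Sum>k\<in>D. P i k z * Q j k z) has_field_derivative 0) (at w)"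
      if w: "w \<in> ball z0 \<rho>" for w
    proof -
      have "((\<lambda>z. \<Sum>k\<in>D. P i k z * Q j k z) has_field_derivative
          (\<Sum>k\<in>D. P i k w * - (\<Sum>l\<in>D. h k l w * Q j l w) + (\<Sum>l\<in>D. P i l w * h l k w) * Q j k w)) (at w)"
        by (rule DERIV_sum, rule DERIV_mult') (use dP dQ ij w in auto)
      also have "(\<Sum>k\<in>D. P i k w * - (\<Sum>l\<in>D. h k l w * Q j l w) + (\<Sum>l\<in>D. P i l w * h l k w) * Q j k w)
          = - (\<Sum>k\<in>D. \<Sum>l\<in>D. P i k w * h k l w * Q j l w) + (\<Sum>k\<in>D. \<Sum>l\<in>D. P i l w * h l k w * Q j k w)"
        by (simp add: sum.distrib sum_negf sum_subtractf sum_distrib_left sum_distrib_right mult.assoc)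
      also have "(\<Sum>k\<in>D. \<Sum>l\<in>D. P i l w * h l k w * Q j k w) = (\<Sum>k\<in>D. \<Sum>l\<in>D. P i k w * h k l w * Q j l w)"
        by (rule sum.swap)
      finally show ?thesis by simp
    qed
    then have "(\<Sum>k\<in>D. P i k z * Q j k z) = (\<Sum>k\<in>D. P i k z0 * Q j k z0)"
      using z by (rule ball_const_if_deriv_zero[where f = "\<lambda>z. \<Sum>k\<in>D. P i k z * Q j k z"])
    also have "\<dots> = (\<Sum>k\<in>D. if k = i then (if i = j then 1 else 0) else 0)"
      using P(3) Q(3) by (intro sum.cong) auto
    finally show ?thesis using ij \<open>finite D\<close> by simp
  qed
  have "0 < \<rho>" "\<rho> \<le> r"
    using P Q by (auto simp: \<rho>_def)
  with P(3) Q(3) dP dQ inv show ?thesis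
    by (intro exI[of _ \<rho>] exI[of _ P] exI[of _ "\<lambda>i j. Q j i"] conjI allI ballI) auto
qed

text \<open>Let \<open>\<phi>\<close> have the matrix \<open>P\<close>, where \<open>P' = P h\<close>. The left hand side of the last equation gives
  the structure constants of the multiplication \<open>g\<close> at \<open>z\<close>, pulled back along \<open>\<phi>\<close>. The coboundary
  hypothesis says that their derivative vanishes, so they keep the value which they have at \<open>z0\<close>.\<close>

lemma structure_constants_transport:
  fixes g g' :: "'i \<Rightarrow> 'i \<Rightarrow> 'i \<Rightarrow> complex \<Rightarrow> complex" and h :: "'i \<Rightarrow> 'i \<Rightarrow> complex \<Rightarrow> complex"
  assumes "finite D" "0 < r"
    and h: "\<forall>i\<in>D. \<forall>j\<in>D. h i j holomorphic_on ball z0 r"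
    and g: "\<And>a b c z. a \<in> D \<Longrightarrow> b \<in> D \<Longrightarrow> c \<in> D \<Longrightarrow> z \<in> ball z0 r \<Longrightarrow>
      (g a b c has_field_derivative g' a b c z) (at z)"
    and coboundary: "\<And>a b c z. a \<in> D \<Longrightarrow> b \<in> D \<Longrightarrow> c \<in> D \<Longrightarrow> z \<in> ball z0 r \<Longrightarrow>
      (\<Sum>f\<in>D. g a b f z * h f c z) =
        g' a b c z + (\<Sum>f\<in>D. h a f z * g f b c z) + (\<Sum>f\<in>D. h b f z * g a f c z)"
  shows "\<exists>\<rho> P Q. 0 < \<rho> \<and> \<rho> \<le> r \<and> (\<forall>z\<in>ball z0 \<rho>.
    (\<forall>a\<in>D. \<forall>b\<in>D. (\<Sum>k\<in>D. P a k z * Q k b z) = (if a = b then 1 else 0)) \<and>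
    (\<forall>a\<in>D. \<forall>b\<in>D. \<forall>c\<in>D.
      (\<Sum>f\<in>D. (\<Sum>d\<in>D. \<Sum>e\<in>D. P a d z * P b e z * g d e f z) * Q f c z) = g a b c z0))"
proof -
  obtain \<rho> P Q where \<rho>: "0 < \<rho>" "\<rho> \<le> r"
    and P0: "\<forall>i j. P i j z0 = (if i = j then 1 else 0)"
    and Q0: "\<forall>i j. Q i j z0 = (if i = j then 1 else 0)"
    and PQ: "\<forall>i\<in>D. \<forall>j\<in>D. \<forall>z\<in>ball z0 \<rho>.
      (P i j has_field_derivative (\<Sum>k\<in>D. P i k z * h k j z)) (at z) \<and>
      (Q i j has_field_derivative - (\<Sum>k\<in>D. h i k z * Q k j z)) (at z) \<and>
      (\<Sum>k\<in>D. P i k z * Q k j z) = (if i = j then 1 else 0)"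
    using linear_ode_inverse_pair[OF assms(1-3)] by (elim exE conjE) (rule that)
  note dP = PQ[rule_format, THEN conjunct1]
    and dQ = PQ[rule_format, THEN conjunct2, THEN conjunct1]
  \<comment> \<open>\<open>m a b\<close> is the product of \<open>\<phi> a\<close> and \<open>\<phi> b\<close> at the parameter \<open>z\<close>. Its three derivative terms
    combine to \<open>m h\<close>, the same equation as for \<open>P\<close>, so that multiplying by \<open>Q\<close> makes it constant.\<close>
  define m where "m a b f z = (\<Sum>d\<in>D. \<Sum>e\<in>D. P a d z * P b e z * g d e f z)" for a b f z
  have dm: "(m a b c has_field_derivative (\<Sum>f\<in>D. m a b f z * h f c z)) (at z)"
    if abc: "a \<in> D" "b \<in> D" "c \<in> D" and z: "z \<in> ball z0 \<rho>" for a b c z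
  proof -
    have zr: "z \<in> ball z0 r" using z \<rho>(2) by auto
    define p where "p i j = (\<Sum>k\<in>D. P i k z * h k j z)" for i j
    have "(m a b c has_field_derivative (\<Sum>d\<in>D. \<Sum>e\<in>D.
        P a d z * P b e z * g' d e c z + (P a d z * p b e + p a d * P b e z) * g d e c z)) (at z)"
      unfolding m_def by (rule DERIV_sum, rule DERIV_sum, rule DERIV_mult', rule DERIV_mult')
        (use dP g abc z zr in \<open>auto simp: p_def\<close>)
    also have "(\<Sum>d\<in>D. \<Sum>e\<in>D.
        P a d z * P b e z * g' d e c z + (P a d z * p b e + p a d * P b e z) * g d e c z) =
      (\<Sum>d\<in>D. \<Sum>e\<in>D. P a d z * P b e z * g' d e c z) +
      (\<Sum>d\<in>D. \<Sum>e\<in>D. P a d z * p b e * g d e c z) + (\<Sum>d\<in>D. \<Sum>e\<in>D. p a d * P b e z * g d e c z)"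
      by (simp add: sum.distrib algebra_simps)
    also have "(\<Sum>d\<in>D. \<Sum>e\<in>D. P a d z * p b e * g d e c z) =
        (\<Sum>d\<in>D. \<Sum>e\<in>D. P a d z * P b e z * (\<Sum>f\<in>D. h e f z * g d f c z))"
    proof (rule sum.cong[OF refl])
      fix d
      have "(\<Sum>e\<in>D. P a d z * p b e * g d e c z) =
          (\<Sum>e\<in>D. \<Sum>k\<in>D. P a d z * P b k z * (h k e z * g d e c z))"
        by (simp add: p_def sum_distrib_left sum_distrib_right mult_ac)
      also have "\<dots> = (\<Sum>k\<in>D. \<Sum>e\<in>D. P a d z * P b k z * (h k e z * g d e c z))"
        by (rule sum.swap)
      finally show "(\<Sum>e\<in>D. P a d z * p b e * g d e c z) =
          (\<Sum>e\<in>D. P a d z * P b e z * (\<Sum>f\<in>D. h e f z * g d f c z))"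
        by (simp add: sum_distrib_left)
    qed
    also have "(\<Sum>d\<in>D. \<Sum>e\<in>D. p a d * P b e z * g d e c z) =
        (\<Sum>d\<in>D. \<Sum>e\<in>D. P a d z * P b e z * (\<Sum>f\<in>D. h d f z * g f e c z))"
    proof -
      have "(\<Sum>d\<in>D. \<Sum>e\<in>D. p a d * P b e z * g d e c z) =
          (\<Sum>e\<in>D. \<Sum>d\<in>D. \<Sum>k\<in>D. P a k z * P b e z * (h k d z * g d e c z))"
        by (subst sum.swap) (simp add: p_def sum_distrib_left sum_distrib_right mult_ac)
      also have "\<dots> = (\<Sum>e\<in>D. \<Sum>k\<in>D. \<Sum>d\<in>D. P a k z * P b e z * (h k d z * g d e c z))"
        by (rule sum.cong[OF refl], rule sum.swap)
      also have "\<dots> = (\<Sum>k\<in>D. \<Sum>e\<in>D. \<Sum>d\<in>D. P a k z * P b e z * (h k d z * g d e c z))"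
        by (rule sum.swap)
      finally show ?thesis by (simp add: sum_distrib_left)
    qed
    also have "(\<Sum>d\<in>D. \<Sum>e\<in>D. P a d z * P b e z * g' d e c z) +
        (\<Sum>d\<in>D. \<Sum>e\<in>D. P a d z * P b e z * (\<Sum>f\<in>D. h e f z * g d f c z)) +
        (\<Sum>d\<in>D. \<Sum>e\<in>D. P a d z * P b e z * (\<Sum>f\<in>D. h d f z * g f e c z)) =
      (\<Sum>d\<in>D. \<Sum>e\<in>D. P a d z * P b e z * (\<Sum>f\<in>D. g d e f z * h f c z))"
      unfolding sum.distrib[symmetric]
      by (intro sum.cong refl) (simp only: coboundary abc zr distrib_left[symmetric] add.commute add.left_commute)
    also have "\<dots> = (\<Sum>d\<in>D. \<Sum>f\<in>D. \<Sum>e\<in>D. P a d z * P b e z * g d e f z * h f c z)"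
      by (rule sum.cong[OF refl], subst sum.swap) (simp add: sum_distrib_left mult.assoc)
    also have "\<dots> = (\<Sum>f\<in>D. m a b f z * h f c z)"
      by (subst sum.swap) (simp add: m_def sum_distrib_right)
    finally show ?thesis .
  qed
  have "(\<Sum>f\<in>D. m a b f z * Q f c z) = g a b c z0"
    if abc: "a \<in> D" "b \<in> D" "c \<in> D" and z: "z \<in> ball z0 \<rho>" for a b c z
  proof -
    have "((\<lambda>z. \<Sum>f\<in>D. m a b f z * Q f c z) has_field_derivative 0) (at w)"
      if w: "w \<in> ball z0 \<rho>" for w
    proof -
      have "((\<lambda>z. \<Sum>f\<in>D. m a b f z * Q f c z) has_field_derivative
          (\<Sum>f\<in>D. m a b f w * - (\<Sum>l\<in>D. h f l w * Q l c w) + (\<Sum>l\<in>D. m a b l w * h l f w) * Q f c w)) (at w)"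
        by (rule DERIV_sum, rule DERIV_mult') (use dm dQ abc w in auto)
      also have "(\<Sum>f\<in>D. m a b f w * - (\<Sum>l\<in>D. h f l w * Q l c w) + (\<Sum>l\<in>D. m a b l w * h l f w) * Q f c w)
          = - (\<Sum>f\<in>D. \<Sum>l\<in>D. m a b f w * h f l w * Q l c w) + (\<Sum>f\<in>D. \<Sum>l\<in>D. m a b l w * h l f w * Q f c w)"
        by (simp add: sum.distrib sum_negf sum_subtractf sum_distrib_left sum_distrib_right mult.assoc)
      also have "(\<Sum>f\<in>D. \<Sum>l\<in>D. m a b l w * h l f w * Q f c w) = (\<Sum>f\<in>D. \<Sum>l\<in>D. m a b f w * h f l w * Q l c w)"
        by (rule sum.swap)
      finally show ?thesis by simp
    qed
    then have "(\<Sum>f\<in>D. m a b f z * Q f c z) = (\<Sum>f\<in>D. m a b f z0 * Q f c z0)"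
      using z by (rule ball_const_if_deriv_zero[where f = "\<lambda>z. \<Sum>f\<in>D. m a b f z * Q f c z"])
    also have "\<dots> = (\<Sum>f\<in>D. if f = c then m a b c z0 else 0)"
      using Q0 by (intro sum.cong) auto
    also have "\<dots> = m a b c z0"
      using abc \<open>finite D\<close> by simp
    also have "\<dots> = (\<Sum>d\<in>D. if d = a then (\<Sum>e\<in>D. if e = b then g a b c z0 else 0) else 0)"
      unfolding m_def using P0 by (intro sum.cong) (auto intro!: sum.cong)
    also have "\<dots> = g a b c z0"
      using abc \<open>finite D\<close> by simp
    finally show ?thesis .
  qed
  then show ?thesis
    using \<rho> PQ unfolding m_def by (intro exI[of _ \<rho>] exI[of _ P] exI[of _ Q]) auto
qed

section \<open>Inverting a holomorphic family of matrices\<close>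

lemma holomorphic_on_det:
  assumes "\<And>z. M z \<in> carrier_mat n n"
    and "\<And>i j. i < n \<Longrightarrow> j < n \<Longrightarrow> (\<lambda>z. M z $$ (i, j)) holomorphic_on W"
  shows "(\<lambda>z. Determinant.det (M z)) holomorphic_on W"
  unfolding det_def'[OF assms(1)]
proof (intro holomorphic_intros assms(2))
  fix p i assume "p \<in> {p. p permutes {0..<n}}" "i \<in> {0..<n}"
  then have "p i \<in> {0..<n}" by (simp only: permutes_in_image mem_Collect_eq)
  then show "p i < n" by simp
qed auto

text \<open>By Cramer's rule the inverse matrix is the adjugate divided by the determinant \<open>\<Delta>\<close>, and both are
  polynomials in the entries.\<close>

lemma holomorphic_inverse_family:
  fixes T :: "'i \<Rightarrow> 'i \<Rightarrow> complex \<Rightarrow> complex"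
  assumes "finite D"
    and T: "\<forall>a\<in>D. \<forall>b\<in>D. T a b holomorphic_on W"
  shows "\<exists>\<Delta> S. \<Delta> holomorphic_on W \<and>
    (\<forall>a\<in>D. \<forall>b\<in>D. S a b holomorphic_on {z \<in> W. \<Delta> z \<noteq> 0}) \<and>
    (\<forall>z. \<Delta> z \<noteq> 0 \<longrightarrow>
      (\<forall>a\<in>D. \<forall>c\<in>D. (\<Sum>b\<in>D. S a b z * T b c z) = (if a = c then 1 else 0))) \<and>
    (\<forall>z. \<Delta> z = 0 \<longrightarrow> (\<exists>v. (\<exists>a\<in>D. v a \<noteq> 0) \<and> (\<forall>a\<in>D. (\<Sum>b\<in>D. T a b z * v b) = 0)))"
proof -
  obtain e where e: "bij_betw e {0..<card D} D"
    using ex_bij_betw_nat_finite[OF \<open>finite D\<close>] by blast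
  define n where "n = card D"
  define e' where "e' = the_inv_into {0..<n} e"
  have e: "bij_betw e {0..<n} D" using e by (simp add: n_def)
  have e'D: "e' a < n" "e (e' a) = a" if "a \<in> D" for a
    using bij_betw_the_inv_into[OF e] f_the_inv_into_f_bij_betw[OF e] that
    by (auto simp: e'_def bij_betw_def)
  have eD: "e i \<in> D" "e' (e i) = i" if "i < n" for i
    using e that unfolding e'_def by (auto simp: bij_betw_def the_inv_into_f_f)
  have sum_D: "(\<Sum>b\<in>D. f b) = (\<Sum>i<n. f (e i))" for f :: "'i \<Rightarrow> complex"
    using sum.reindex_bij_betw[OF e, of f] by (simp add: atLeast0LessThan)
  define M where "M z = mat n n (\<lambda>(i, j). T (e i) (e j) z)" for z
  define \<Delta> where "\<Delta> z = Determinant.det (M z)" for z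
  define S where "S a b z = adj_mat (M z) $$ (e' a, e' b) / \<Delta> z" for a b z
  have M: "M z \<in> carrier_mat n n" and dim: "dim_row (M z) = n" "dim_col (M z) = n" for z
    by (simp_all add: M_def)
  have Mh: "(\<lambda>z. M z $$ (i, j)) holomorphic_on W" if "i < n" "j < n" for i j
    using T eD(1)[OF that(1)] eD(1)[OF that(2)] that by (simp add: M_def)
  show ?thesis
  proof (intro exI[of _ \<Delta>] exI[of _ S] conjI allI ballI impI)
    show hol: "\<Delta> holomorphic_on W"
      unfolding \<Delta>_def using M Mh by (rule holomorphic_on_det)
    show "S a b holomorphic_on {z \<in> W. \<Delta> z \<noteq> 0}" if "a \<in> D" "b \<in> D" for a b
    proof -
      have "(\<lambda>z. Determinant.det (mat_delete (M z) (e' b) (e' a))) holomorphic_on W"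
      proof (rule holomorphic_on_det)
        show "mat_delete (M z) (e' b) (e' a) \<in> carrier_mat (n - 1) (n - 1)" for z
          using M[of z] by (rule mat_delete_carrier)
        fix i j assume "i < n - 1" "j < n - 1"
        then have "(\<lambda>z. mat_delete (M z) (e' b) (e' a) $$ (i, j)) =
            (\<lambda>z. M z $$ (if i < e' b then i else Suc i, if j < e' a then j else Suc j))"
          by (intro ext) (simp add: mat_delete_def dim)
        then show "(\<lambda>z. mat_delete (M z) (e' b) (e' a) $$ (i, j)) holomorphic_on W"
          using \<open>i < n - 1\<close> \<open>j < n - 1\<close> by (auto intro!: Mh)
      qed
      then have "(\<lambda>z. adj_mat (M z) $$ (e' a, e' b)) holomorphic_on W"
        using e'D[OF that(1)] e'D[OF that(2)]
        by (auto simp: adj_mat_def cofactor_def dim intro!: holomorphic_intros)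
      then show ?thesis
        unfolding S_def using hol
        by (intro holomorphic_on_divide) (auto elim: holomorphic_on_subset)
    qed
    show "(\<Sum>b\<in>D. S a b z * T b c z) = (if a = c then 1 else 0)"
      if "\<Delta> z \<noteq> 0" "a \<in> D" "c \<in> D" for z a c
    proof -
      have adj: "adj_mat (M z) \<in> carrier_mat n n" "adj_mat (M z) * M z = \<Delta> z \<cdot>\<^sub>m 1\<^sub>m n"
        using adj_mat(1,3)[OF M[of z]] by (auto simp: \<Delta>_def)
      have "(\<Sum>b\<in>D. S a b z * T b c z) =
          (\<Sum>i<n. adj_mat (M z) $$ (e' a, i) * M z $$ (i, e' c)) / \<Delta> z"
        using e'D[OF that(2)] e'D[OF that(3)]
        by (simp add: sum_D sum_divide_distrib S_def eD M_def)
      also have "(\<Sum>i<n. adj_mat (M z) $$ (e' a, i) * M z $$ (i, e' c)) =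
          (adj_mat (M z) * M z) $$ (e' a, e' c)"
        using adj(1) M[of z] e'D[OF that(2)] e'D[OF that(3)]
        by (simp add: scalar_prod_def atLeast0LessThan)
      also have "\<dots> = \<Delta> z * (if a = c then 1 else 0)"
        using e'D[OF that(2)] e'D[OF that(3)] by (auto simp: adj(2))
      finally show ?thesis using that(1) by simp
    qed
    show "\<exists>v. (\<exists>a\<in>D. v a \<noteq> 0) \<and> (\<forall>a\<in>D. (\<Sum>b\<in>D. T a b z * v b) = 0)" if zero: "\<Delta> z = 0" for z
    proof -
      obtain v where v: "v \<in> carrier_vec n" "v \<noteq> 0\<^sub>v n" "M z *\<^sub>v v = 0\<^sub>v n"
        using zero det_0_iff_vec_prod_zero[OF M[of z]] by (auto simp: \<Delta>_def)
      obtain i where i: "i < n" "vec_index v i \<noteq> 0"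
        using v(1,2) by (auto simp: vec_eq_iff)
      have "(\<Sum>b\<in>D. T a b z * vec_index v (e' b)) = 0" if "a \<in> D" for a
      proof -
        have "(\<Sum>b\<in>D. T a b z * vec_index v (e' b)) = vec_index (M z *\<^sub>v v) (e' a)"
          using e'D[OF that] v(1) by (simp add: sum_D eD M_def scalar_prod_def atLeast0LessThan)
        then show ?thesis using e'D[OF that] by (simp add: v(3))
      qed
      then show ?thesis
        using i eD[OF i(1)] by (intro exI[of _ "\<lambda>b. vec_index v (e' b)"]) (auto intro!: bexI[of _ "e i"])
    qed
  qed
qed

section \<open>The fibres of a convergent deformation\<close>

text \<open>The structure series are assumed to converge on the open disc of radius \<open>r\<close> about 0, so that
  there is a fibre for every complex parameter in this disc and not only for the real ones.\<close>

locale convergent_deformation = formal_deformation N star + based_space "alg_scale N" D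
  for N :: "'a::ab_group_add alg" and star D +
  fixes r :: real
  assumes radius: "\<And>a b c. a \<in> D \<Longrightarrow> b \<in> D \<Longrightarrow> c \<in> D \<Longrightarrow>
    ereal r \<le> fps_conv_radius (structure_series N D star a b c)"
begin

abbreviation G :: "'a \<Rightarrow> 'a \<Rightarrow> 'a \<Rightarrow> complex fps" where
  "G \<equiv> structure_series N D star"

abbreviation fibre :: "complex \<Rightarrow> 'a alg" where
  "fibre z \<equiv> specialisation N D star z"

text \<open>The formal power series over \<open>N\<close> form a free module over the complex power series with basis
  \<open>D\<close>; these are the coordinates in it.\<close>

definition coord_series :: "'a fps \<Rightarrow> 'a \<Rightarrow> complex fps" where
  "coord_series f e = Abs_fps (\<lambda>k. coord (fps_nth f k) e)"

lemma coord_series_simps: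
  "coord_series (sum f I) e = (\<Sum>i\<in>I. coord_series (f i) e)"
  "coord_series (fps_act N p h) e = p * coord_series h e"
  "coord_series (star (fps_const a) (fps_const b)) c = G a b c"
  "coord_series (fps_const x) e = fps_const (coord x e)"
  by (auto intro!: fps_ext simp: coord_series_def coord_simps fps_sum_nth fps_act_def fps_mult_nth
      atLeast0AtMost structure_series_def representation_zero)

lemma star_sum_left: "star (sum f I) h = (\<Sum>i\<in>I. star (f i) h)"
proof -
  have "star 0 h = 0" using star_add_left[of 0 0 h] by simp
  then show ?thesis
    by (induction I rule: infinite_finite_induct) (auto simp: star_add_left)
qed

lemma star_sum_right: "star h (sum f I) = (\<Sum>i\<in>I. star h (f i))"
proof -
  have "star h 0 = 0" using star_add_right[of h 0 0] by simp
  then show ?thesis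
    by (induction I rule: infinite_finite_induct) (auto simp: star_add_right)
qed

lemma alg_basis_D: "alg_basis N D"
  unfolding alg_basis_def by (rule finite_dimensional_vector_space_axioms)

lemma structure_series_assoc:
  "(\<Sum>d\<in>D. G a b d * G d c e) = (\<Sum>d\<in>D. G b c d * G a d e)"
proof -
  have "coord_series (star (star (fps_const a) (fps_const b)) (fps_const c)) e =
      (\<Sum>d\<in>D. G a b d * G d c e)"
    unfolding star_basis[OF alg_basis_D, of star a b]
    by (simp add: star_sum_left star_act_left coord_series_simps)
  moreover have "coord_series (star (fps_const a) (star (fps_const b) (fps_const c))) e =
      (\<Sum>d\<in>D. G b c d * G a d e)"
    unfolding star_basis[OF alg_basis_D, of star b c]
    by (simp add: star_sum_right star_act_right coord_series_simps)
  ultimately show ?thesis by (simp add: star_assoc)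
qed

lemma fps_const_expand:
  "fps_const x = (\<Sum>a\<in>D. fps_act N (fps_const (coord x a)) (fps_const a))"
proof -
  have "fps_act N (fps_const k) (fps_const a) = fps_const (alg_scale N k a)" for k a
  proof (rule fps_ext)
    fix n
    show "fps_nth (fps_act N (fps_const k) (fps_const a)) n = fps_nth (fps_const (alg_scale N k a)) n"
      by (cases "n = 0") (auto simp: fps_act_def intro!: sum.neutral)
  qed
  then show ?thesis
    by (intro fps_ext) (auto simp: fps_sum_nth sum_coord)
qed

lemma structure_series_one:
  assumes "b \<in> D"
  shows "(\<Sum>a\<in>D. fps_const (coord (alg_one N) a) * G a b c) = fps_const (if c = b then 1 else 0)"
    and "(\<Sum>a\<in>D. fps_const (coord (alg_one N) a) * G b a c) = fps_const (if c = b then 1 else 0)"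
proof -
  have "coord_series (star (fps_const (alg_one N)) (fps_const b)) c =
      (\<Sum>a\<in>D. fps_const (coord (alg_one N) a) * G a b c)"
    by (subst fps_const_expand[of "alg_one N"]) (simp add: star_sum_left star_act_left coord_series_simps)
  moreover have "coord_series (star (fps_const b) (fps_const (alg_one N))) c =
      (\<Sum>a\<in>D. fps_const (coord (alg_one N) a) * G b a c)"
    by (subst fps_const_expand[of "alg_one N"]) (simp add: star_sum_right star_act_right coord_series_simps)
  ultimately show "(\<Sum>a\<in>D. fps_const (coord (alg_one N) a) * G a b c) = fps_const (if c = b then 1 else 0)"
    and "(\<Sum>a\<in>D. fps_const (coord (alg_one N) a) * G b a c) = fps_const (if c = b then 1 else 0)"
    by (simp_all add: star_one_left star_one_right coord_series_simps coord_Basis[OF assms])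
qed

text \<open>The structure constants as functions of the parameter, and their derivatives.\<close>

definition g :: "'a \<Rightarrow> 'a \<Rightarrow> 'a \<Rightarrow> complex \<Rightarrow> complex" where
  "g a b c z = eval_fps (G a b c) z"

definition g' :: "'a \<Rightarrow> 'a \<Rightarrow> 'a \<Rightarrow> complex \<Rightarrow> complex" where
  "g' a b c z = eval_fps (fps_deriv (G a b c)) z"

lemma series_conv_radius:
  fixes z :: complex
  assumes "z \<in> ball 0 r" "a \<in> D" "b \<in> D" "c \<in> D"
  shows "ereal (norm z) < fps_conv_radius (G a b c)"
    and "ereal (norm z) < fps_conv_radius (fps_deriv (G a b c))"
proof -
  show 1: "ereal (norm z) < fps_conv_radius (G a b c)"
    by (rule less_le_trans[OF _ radius]) (use assms in auto)
  show "ereal (norm z) < fps_conv_radius (fps_deriv (G a b c))"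
    by (rule less_le_trans[OF 1 fps_conv_radius_deriv])
qed

lemma g_deriv:
  assumes "z \<in> ball 0 r" "a \<in> D" "b \<in> D" "c \<in> D"
  shows "(g a b c has_field_derivative g' a b c z) (at z)"
proof -
  have "(eval_fps (G a b c) has_field_derivative g' a b c z) (at z)"
    unfolding g'_def by (rule has_field_derivative_eval_fps) (rule series_conv_radius[OF assms])
  then show ?thesis by (simp add: g_def[abs_def])
qed

lemma g_holomorphic:
  assumes "a \<in> D" "b \<in> D" "c \<in> D"
  shows "g a b c holomorphic_on ball 0 r" "g' a b c holomorphic_on ball 0 r"
proof -
  have sub: "ball (0::complex) r \<subseteq> eball 0 (fps_conv_radius (G a b c))"
    "ball (0::complex) r \<subseteq> eball 0 (fps_conv_radius (fps_deriv (G a b c)))"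
    using series_conv_radius[OF _ assms] by (auto simp: in_eball_iff)
  show "g a b c holomorphic_on ball 0 r" "g' a b c holomorphic_on ball 0 r"
    unfolding g_def[abs_def] g'_def[abs_def] by (rule holomorphic_on_eval_fps, rule sub)+
qed

lemma g_assoc:
  assumes "z \<in> ball 0 r" "a \<in> D" "b \<in> D" "c \<in> D" "e \<in> D"
  shows "(\<Sum>d\<in>D. g a b d z * g d c e z) = (\<Sum>d\<in>D. g b c d z * g a d e z)"
  using arg_cong[OF structure_series_assoc[of a b c e], of "\<lambda>f. eval_fps f z"] series_conv_radius[OF assms(1)] assms
  by (simp add: eval_fps_sum_mult g_def)

text \<open>Differentiating associativity in the parameter yields the cocycle identity for the derivative of
  the multiplication.\<close>

lemma g_cocycle:
  assumes "z \<in> ball 0 r" "a \<in> D" "b \<in> D" "c \<in> D" "e \<in> D"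
  shows "(\<Sum>d\<in>D. g' b c d z * g a d e z) + (\<Sum>d\<in>D. g b c d z * g' a d e z) =
    (\<Sum>d\<in>D. g a b d z * g' d c e z) + (\<Sum>d\<in>D. g' a b d z * g d c e z)"
proof -
  have d: "((\<lambda>w. \<Sum>d\<in>D. g a b d w * g d c e w) has_field_derivative
      (\<Sum>d\<in>D. g a b d z * g' d c e z + g' a b d z * g d c e z)) (at z)"
    by (rule DERIV_sum, rule DERIV_mult') (use g_deriv assms in auto)
  have "((\<lambda>w. \<Sum>d\<in>D. g b c d w * g a d e w) has_field_derivative
      (\<Sum>d\<in>D. g b c d z * g' a d e z + g' b c d z * g a d e z)) (at z)"
    by (rule DERIV_sum, rule DERIV_mult') (use g_deriv assms in auto)
  moreover have "((\<lambda>w. \<Sum>d\<in>D. g b c d w * g a d e w) has_field_derivative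
      (\<Sum>d\<in>D. g a b d z * g' d c e z + g' a b d z * g d c e z)) (at z)"
    by (rule has_field_derivative_transform_within_open[OF d open_ball assms(1)])
       (rule g_assoc[OF _ assms(2-)])
  ultimately show ?thesis
    using DERIV_unique by (fastforce simp: sum.distrib)
qed

lemma alg_scale_fibre: "alg_scale (fibre z) = alg_scale N"
  by (simp add: specialisation_def)

lemma fibre_eq: "fibre z = N\<lparr>alg_mult := bilinear_ext (\<lambda>a b c. g a b c z)\<rparr>"
  unfolding specialisation_def bilinear_ext_def[abs_def] g_def ..

lemma based_algebra_fibre:
  assumes "z \<in> ball 0 r"
  shows "based_algebra (fibre z) D"
  unfolding fibre_eq
proof (rule based_algebra_bilinear_ext)
  fix b c assume bc: "b \<in> D" "c \<in> D"
  show "(\<Sum>a\<in>D. coord (alg_one N) a * g a b c z) = (if c = b then 1 else 0)"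
    using arg_cong[OF structure_series_one(1)[OF bc(1), of c], of "\<lambda>f. eval_fps f z"] series_conv_radius[OF assms] bc
    by (simp add: eval_fps_sum_mult g_def)
  show "(\<Sum>a\<in>D. coord (alg_one N) a * g b a c z) = (if c = b then 1 else 0)"
    using arg_cong[OF structure_series_one(2)[OF bc(1), of c], of "\<lambda>f. eval_fps f z"] series_conv_radius[OF assms] bc
    by (simp add: eval_fps_sum_mult g_def)
qed (use g_assoc[OF assms] in auto)

lemma coord_fibre_mult:
  "a \<in> D \<Longrightarrow> b \<in> D \<Longrightarrow> c \<in> D \<Longrightarrow> coord (alg_mult (fibre z) a b) c = g a b c z"
  by (simp add: fibre_eq coord_bilinear_ext_Basis)

text \<open>The Gram matrix of the trace form of the fibre at \<open>z\<close>, written as a polynomial in the structure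
  constants to make it visibly holomorphic.\<close>

definition gram :: "'a \<Rightarrow> 'a \<Rightarrow> complex \<Rightarrow> complex" where
  "gram a b z = (\<Sum>d\<in>D. \<Sum>e\<in>D. g a b e z * g e d d z)"

lemma trace_form_fibre:
  assumes z: "z \<in> ball 0 r" and ab: "a \<in> D" "b \<in> D"
  shows "based_algebra.trace_form (fibre z) D a b = gram a b z"
proof -
  interpret F: based_algebra "fibre z" D rewrites "alg_scale (fibre z) = alg_scale N"
    by (fact based_algebra_fibre[OF z] alg_scale_fibre)+
  have "coord (F.mul (F.mul a b) d) d = (\<Sum>e\<in>D. g a b e z * g e d d z)" if d: "d \<in> D" for d
  proof -
    have "F.mul a b = (\<Sum>e\<in>D. alg_scale N (g a b e z) e)"
      using sum_coord[of "F.mul a b"] ab by (simp add: coord_fibre_mult)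
    then show ?thesis
      using d by (simp add: F.mul_simps coord_simps coord_fibre_mult)
  qed
  then show ?thesis
    by (simp add: F.trace_form_def lin_trace_def gram_def)
qed

text \<open>The derivative of the multiplication is a cocycle, hence the coboundary of a matrix \<open>h\<close> that
  depends holomorphically on the parameter. Integrating \<open>h\<close> gives isomorphisms from the fibre at
  \<open>z0\<close> to the fibres nearby.\<close>

lemma fibre_rigid:
  assumes z0: "z0 \<in> ball 0 r" "0 < \<rho>" "ball z0 \<rho> \<subseteq> ball 0 r"
    and S: "\<And>a b. a \<in> D \<Longrightarrow> b \<in> D \<Longrightarrow> S a b holomorphic_on ball z0 \<rho>"
    and dual: "\<And>a c z. a \<in> D \<Longrightarrow> c \<in> D \<Longrightarrow> z \<in> ball z0 \<rho> \<Longrightarrow>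
      (\<Sum>b\<in>D. S a b z * gram b c z) = (if a = c then 1 else 0)"
  shows "\<exists>\<delta>>0. \<forall>w\<in>ball z0 \<delta>. fibre z0 \<cong>\<^sub>a fibre w"
proof -
  define h where "h x c z = - (\<Sum>a\<in>D. \<Sum>b\<in>D. \<Sum>d\<in>D. S a b z * g' b x d z * g a d c z)" for x c z
  have h: "\<forall>i\<in>D. \<forall>j\<in>D. h i j holomorphic_on ball z0 \<rho>"
    unfolding h_def[abs_def]
    by (intro ballI holomorphic_intros S holomorphic_on_subset[OF _ z0(3)] g_holomorphic)
  have "\<exists>\<delta> P Q. 0 < \<delta> \<and> \<delta> \<le> \<rho> \<and> (\<forall>z\<in>ball z0 \<delta>.
      (\<forall>a\<in>D. \<forall>b\<in>D. (\<Sum>k\<in>D. P a k z * Q k b z) = (if a = b then 1 else 0)) \<and>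
      (\<forall>a\<in>D. \<forall>b\<in>D. \<forall>c\<in>D.
        (\<Sum>f\<in>D. (\<Sum>d\<in>D. \<Sum>e\<in>D. P a d z * P b e z * g d e f z) * Q f c z) = g a b c z0))"
  proof (rule structure_constants_transport[OF finite_Basis z0(2) h])
    fix a b c z assume abc: "a \<in> D" "b \<in> D" "c \<in> D" and z: "z \<in> ball z0 \<rho>"
    then have zr: "z \<in> ball 0 r" using z0(3) by blast
    show "(g a b c has_field_derivative g' a b c z) (at z)"
      by (rule g_deriv[OF zr abc])
    interpret F: based_algebra "fibre z" D rewrites "alg_scale (fibre z) = alg_scale N"
      by (fact based_algebra_fibre[OF zr] alg_scale_fibre)+
    have "(\<Sum>f\<in>D. coord (F.mul a b) f * h f c z) =
      g' a b c z + (\<Sum>f\<in>D. h a f z * coord (F.mul f b) c) + (\<Sum>f\<in>D. h b f z * coord (F.mul a f) c)"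
    proof -
      have hz: "h x c z = - (\<Sum>a\<in>D. \<Sum>b\<in>D. \<Sum>d\<in>D. S a b z * g' b x d z * coord (F.mul a d) c)"
        if "c \<in> D" for x c
        unfolding h_def using that by (simp add: coord_fibre_mult)
      show ?thesis
        using F.coboundary_coordinates[where S = "\<lambda>a b. S a b z" and F = "\<lambda>a b c. g' a b c z", OF _ _ abc]
          dual[OF _ _ z] g_cocycle[OF zr] abc
        by (simp add: hz trace_form_fibre[OF zr] coord_fibre_mult)
    qed
    then show "(\<Sum>f\<in>D. g a b f z * h f c z) =
        g' a b c z + (\<Sum>f\<in>D. h a f z * g f b c z) + (\<Sum>f\<in>D. h b f z * g a f c z)"
      using abc by (simp add: coord_fibre_mult)
  qed
  then obtain \<delta> P Q where \<delta>: "0 < \<delta>" "\<delta> \<le> \<rho>" and PQ: "\<forall>z\<in>ball z0 \<delta>.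
      (\<forall>a\<in>D. \<forall>b\<in>D. (\<Sum>k\<in>D. P a k z * Q k b z) = (if a = b then 1 else 0)) \<and>
      (\<forall>a\<in>D. \<forall>b\<in>D. \<forall>c\<in>D.
        (\<Sum>f\<in>D. (\<Sum>d\<in>D. \<Sum>e\<in>D. P a d z * P b e z * g d e f z) * Q f c z) = g a b c z0)"
    by (elim exE conjE) (rule that)
  have "fibre z0 \<cong>\<^sub>a fibre w" if w: "w \<in> ball z0 \<delta>" for w
  proof (rule alg_iso_if_coordinate_iso[where P = "\<lambda>a b. P a b w" and Q = "\<lambda>a b. Q a b w"])
    have "w \<in> ball z0 \<rho>" using w \<delta>(2) by simp
    then have "w \<in> ball 0 r" using z0(3) by blast
    then show "based_algebra (fibre z0) D" "based_algebra (fibre w) D"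
      using z0(1) by (auto intro: based_algebra_fibre)
  qed (use PQ w in \<open>simp_all add: alg_scale_fibre coord_fibre_mult\<close>)
  with \<delta>(1) show ?thesis by blast
qed

text \<open>The function \<open>\<Delta>\<close> is the determinant of the Gram matrix of the trace form. Off its zeros the Gram
  matrix has a holomorphic inverse, which is what rigidity needs. At a zero the trace form has a
  nonzero radical, which semisimplicity excludes.\<close>

lemma discriminant_exists:
  "\<exists>\<Delta>. \<Delta> holomorphic_on ball 0 r \<and>
    (\<forall>z\<in>ball 0 r. semisimple_algebra (fibre z) \<longrightarrow> \<Delta> z \<noteq> 0) \<and>
    (\<forall>z\<in>ball 0 r. \<Delta> z \<noteq> 0 \<longrightarrow> (\<exists>\<delta>>0. \<forall>w\<in>ball z \<delta>. fibre z \<cong>\<^sub>a fibre w))"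
proof -
  have gram: "\<forall>a\<in>D. \<forall>b\<in>D. gram a b holomorphic_on ball 0 r"
    unfolding gram_def[abs_def] by (intro ballI holomorphic_intros g_holomorphic)
  obtain \<Delta> S where hol: "\<Delta> holomorphic_on ball 0 r"
    and S: "\<forall>a\<in>D. \<forall>b\<in>D. S a b holomorphic_on {z \<in> ball 0 r. \<Delta> z \<noteq> 0}"
    and dual: "\<forall>z. \<Delta> z \<noteq> 0 \<longrightarrow>
      (\<forall>a\<in>D. \<forall>c\<in>D. (\<Sum>b\<in>D. S a b z * gram b c z) = (if a = c then 1 else 0))"
    and degenerate: "\<forall>z. \<Delta> z = 0 \<longrightarrow>
      (\<exists>v. (\<exists>a\<in>D. v a \<noteq> 0) \<and> (\<forall>a\<in>D. (\<Sum>b\<in>D. gram a b z * v b) = 0))"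
    using holomorphic_inverse_family[OF finite_Basis gram] by (elim exE conjE) (rule that)
  have "\<Delta> z \<noteq> 0" if z: "z \<in> ball 0 r" and ss: "semisimple_algebra (fibre z)" for z
  proof
    interpret F: based_algebra "fibre z" D rewrites "alg_scale (fibre z) = alg_scale N"
      by (fact based_algebra_fibre[OF z] alg_scale_fibre)+
    assume "\<Delta> z = 0"
    then obtain v a where v: "a \<in> D" "v a \<noteq> 0" "\<forall>a\<in>D. (\<Sum>b\<in>D. gram a b z * v b) = 0"
      using degenerate by blast
    define x where "x = (\<Sum>b\<in>D. alg_scale N (v b) b)"
    have basis: "F.trace_form x c = 0" if "c \<in> D" for c
    proof -
      have "F.trace_form c x = (\<Sum>b\<in>D. v b * gram c b z)"
        unfolding x_def using that
        by (simp add: F.trace_form_sum F.trace_form_right_simps trace_form_fibre[OF z])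
      then show ?thesis using v(3) that by (simp add: F.trace_form_commute[of x] mult.commute)
    qed
    have "F.trace_form x y = 0" for y
    proof -
      have "F.trace_form x (\<Sum>c\<in>D. alg_scale N (coord y c) c) = 0"
        by (simp add: F.trace_form_sum F.trace_form_right_simps basis)
      then show ?thesis by (simp add: sum_coord)
    qed
    then have "x = 0" by (rule F.trace_form_nondegenerate_if_semisimple[OF ss])
    then have "coord x a = 0" by (simp add: representation_zero)
    then show False using v(1,2) by (simp add: x_def coord_sum_Basis)
  qed
  moreover have "\<exists>\<delta>>0. \<forall>w\<in>ball z \<delta>. fibre z \<cong>\<^sub>a fibre w" if z: "z \<in> ball 0 r" "\<Delta> z \<noteq> 0" for z
  proof -
    have "open (ball 0 r \<inter> \<Delta> -` (- {0}))"
      using hol by (intro continuous_open_preimage holomorphic_on_imp_continuous_on) auto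
    moreover have "z \<in> ball 0 r \<inter> \<Delta> -` (- {0})" using z by simp
    ultimately obtain \<rho> where \<rho>: "0 < \<rho>" "ball z \<rho> \<subseteq> ball 0 r \<inter> \<Delta> -` (- {0})"
      by (rule openE)
    show ?thesis
    proof (rule fibre_rigid[where S = S, OF z(1) \<rho>(1)])
      show "S a b holomorphic_on ball z \<rho>" if "a \<in> D" "b \<in> D" for a b
        by (rule holomorphic_on_subset[OF S[rule_format, OF that]]) (use \<rho>(2) in auto)
      show "(\<Sum>b\<in>D. S a b w * gram b c w) = (if a = c then 1 else 0)"
        if "a \<in> D" "c \<in> D" "w \<in> ball z \<rho>" for a c w
        using dual that(1,2) subsetD[OF \<rho>(2) that(3)] by simp
    qed (use \<rho> in auto)
  qed
  ultimately show ?thesis using hol by blast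
qed

end

section \<open>Deformations to semisimple algebras\<close>

lemma countable_zeros_ball:
  assumes hol: "\<Delta> holomorphic_on ball 0 r" and w: "w \<in> ball 0 r" "\<Delta> w \<noteq> 0"
  shows "countable {z \<in> ball 0 r. \<Delta> z = 0}"
proof (cases "\<Delta> constant_on ball 0 r")
  case True
  then have "{z \<in> ball 0 r. \<Delta> z = 0} = {}"
    using w by (auto simp: constant_on_def)
  then show ?thesis by (simp only: countable_empty)
next
  case False
  obtain C :: "nat \<Rightarrow> complex set" where "\<And>n. compact (C n)" "\<Union>(range C) = ball 0 r"
    using open_Union_compact_subsets[OF open_ball[of 0 r]] by metis
  then have "fsigma (ball (0::complex) r)"
    using fsigma.intros[of C] by (simp add: compact_imp_closed)
  with False show ?thesis
    by (intro holomorphic_countable_zeros[OF hol]) auto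
qed

text \<open>Convergence on a real interval that ends at \<open>r\<close> already forces the radius of convergence to be at
  least \<open>r\<close>.\<close>

lemma convergent_deformationI:
  assumes "formal_deformation N star" "alg_basis N D"
    and conv: "\<forall>s\<in>{0<..<r}. converges_at N D star (complex_of_real s)"
  shows "convergent_deformation N star D r"
proof -
  have "ereal r \<le> fps_conv_radius (structure_series N D star a b c)" if "a \<in> D" "b \<in> D" "c \<in> D" for a b c
    unfolding fps_conv_radius_def
  proof (rule conv_radius_geI_ex')
    fix s assume "0 < s" "ereal s < ereal r"
    then show "summable (\<lambda>n. fps_nth (structure_series N D star a b c) n * complex_of_real s ^ n)"
      using conv that by (auto simp: converges_at_def)
  qed
  then show ?thesis
    using assms(1,2)
    by (simp add: convergent_deformation_def convergent_deformation_axioms_def based_space_def alg_basis_def)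
qed

lemma converges_at_0: "converges_at N D star 0"
  by (auto simp: converges_at_def power_0_left if_distrib cong: if_cong)

theorem theorem2:
  fixes N :: "'a::ab_group_add alg"
    and A :: "'b::ab_group_add alg"
    and B :: "'c::ab_group_add alg"
    and D :: "'a set"
    and star :: "'a fps \<Rightarrow> 'a fps \<Rightarrow> 'a fps"
  assumes "fin_dim_algebra N" and "fin_dim_algebra A" and "fin_dim_algebra B"
    and "alg_dim A = alg_dim N" and "alg_dim B = alg_dim N"
    and "semisimple_algebra A" and "semisimple_algebra B"
    and "alg_basis N D"
    and "formal_deformation N star"
    and "flat_deformation N D star A"
    and "flat_deformation N D star B"
  shows "A \<cong>\<^sub>a B \<and> strongly_flat_deformation N D star A"
proof -
  obtain cA tA where A: "cA > 0" "\<forall>s\<in>{0<..<cA}. converges_at N D star (complex_of_real s)"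
    "0 < tA" "tA < cA" "specialisation N D star (complex_of_real tA) \<cong>\<^sub>a A"
    using assms(10) by (auto simp: flat_deformation_def)
  obtain cB tB where B: "\<forall>s\<in>{0<..<cB}. converges_at N D star (complex_of_real s)"
    "0 < tB" "tB < cB" "specialisation N D star (complex_of_real tB) \<cong>\<^sub>a B"
    using assms(11) by (auto simp: flat_deformation_def)
  define r where "r = max cA cB"
  interpret convergent_deformation N star D r
    by (rule convergent_deformationI[OF assms(9,8)]) (use A(2) B(1) in \<open>auto simp: r_def max_def\<close>)
  have tA: "complex_of_real tA \<in> ball 0 r" and tB: "complex_of_real tB \<in> ball 0 r"
    using A B by (auto simp: r_def)
  obtain \<Delta> where hol: "\<Delta> holomorphic_on ball 0 r"
    and ss: "\<forall>z\<in>ball 0 r. semisimple_algebra (fibre z) \<longrightarrow> \<Delta> z \<noteq> 0"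
    and rigid: "\<forall>z\<in>ball 0 r. \<Delta> z \<noteq> 0 \<longrightarrow> (\<exists>\<delta>>0. \<forall>w\<in>ball z \<delta>. fibre z \<cong>\<^sub>a fibre w)"
    using discriminant_exists by (elim exE conjE) (rule that)
  have \<Delta>A: "\<Delta> (complex_of_real tA) \<noteq> 0" and \<Delta>B: "\<Delta> (complex_of_real tB) \<noteq> 0"
    using ss tA tB semisimple_if_alg_iso[OF A(5) assms(6)] semisimple_if_alg_iso[OF B(4) assms(7)]
    by blast+
  define Z where "Z = {z \<in> ball 0 r. \<Delta> z = 0}"
  have Z: "countable Z"
    unfolding Z_def by (rule countable_zeros_ball[OF hol tA \<Delta>A])
  \<comment> \<open>The zeros of \<open>\<Delta>\<close> may separate \<open>tA\<close> from \<open>tB\<close> on the real line, but a countable set does not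
    disconnect a complex disc.\<close>
  have "connected (ball 0 r - Z)"
    by (rule connected_open_diff_countable) (use Z in auto)
  then have iso: "fibre z \<cong>\<^sub>a fibre w" if "z \<in> ball 0 r - Z" "w \<in> ball 0 r - Z" for z w
  proof (rule connected_equivalence_relation[OF _ that])
    fix z assume z: "z \<in> ball 0 r - Z"
    then obtain \<delta> where \<delta>: "\<delta> > 0" "\<forall>w\<in>ball z \<delta>. fibre z \<cong>\<^sub>a fibre w"
      using rigid by (auto simp: Z_def)
    show "\<exists>T. openin (top_of_set (ball 0 r - Z)) T \<and> z \<in> T \<and> (\<forall>w\<in>T. fibre z \<cong>\<^sub>a fibre w)"
      using z \<delta> by (intro exI[of _ "(ball 0 r - Z) \<inter> ball z \<delta>"]) (auto simp: openin_open)
  qed (auto intro: alg_iso_sym alg_iso_trans)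
  have AB: "fibre (complex_of_real tA) \<cong>\<^sub>a fibre (complex_of_real tB)"
    by (rule iso) (use tA tB \<Delta>A \<Delta>B in \<open>auto simp: Z_def\<close>)
  have "A \<cong>\<^sub>a B"
    by (rule alg_iso_trans[OF alg_iso_sym[OF A(5)] alg_iso_trans[OF AB B(4)]])
  moreover have "converges_at N D star (complex_of_real s)" if "s \<in> {0..<cA}" for s
    using A(2) that by (cases "s = 0") (auto simp: converges_at_0)
  moreover have "\<exists>s>0. s < \<epsilon> \<and> s < cA \<and> fibre (complex_of_real s) \<cong>\<^sub>a A" if "\<epsilon> > 0" for \<epsilon>
  proof -
    \<comment> \<open>The interval is too large to consist of zeros of \<open>\<Delta>\<close>, so one of its points has a fibre that is
      isomorphic to the one at \<open>tA\<close>.\<close>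
    have "uncountable {0<..<min \<epsilon> cA}"
      using that A(1) by (simp add: uncountable_open_interval)
    moreover have "inj_on complex_of_real {0<..<min \<epsilon> cA}"
      by (simp add: inj_on_def)
    ultimately have "\<not> complex_of_real ` {0<..<min \<epsilon> cA} \<subseteq> Z"
      using Z by (metis countable_image_inj_on countable_subset)
    then obtain s where "s \<in> {0<..<min \<epsilon> cA}" "complex_of_real s \<notin> Z"
      by blast
    then have s: "0 < s" "s < \<epsilon>" "s < cA" "complex_of_real s \<notin> Z"
      by simp_all
    have "fibre (complex_of_real s) \<cong>\<^sub>a fibre (complex_of_real tA)"
      by (rule iso) (use s tA \<Delta>A in \<open>auto simp: Z_def r_def\<close>)
    then have "fibre (complex_of_real s) \<cong>\<^sub>a A"
      using A(5) by (rule alg_iso_trans)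
    then show ?thesis
      using s by blast
  qed
  ultimately show ?thesis
    unfolding strongly_flat_deformation_def
    using assms(9) A by (intro conjI exI[of _ cA]) auto
qed

end
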